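(* Let $\Sigma$ be a finite set, $M=\mathbb C[\Sigma]$ with differential calculus $\Omega^1(M)=\mathbb CE$ given by a subset $E\subseteq\Sigma\times\Sigma\setminus\text{diagonal}$, and $H$ a Hopf algebra. A $V$-bein for $\Sigma$ is the same as a vector space $V$ on which $H$ coacts and 1-forms $$E_a=\sum_{(x,y)\in E}E_{a,x,y}\,\delta_x\otimes\delta_y$$ for each element of a basis $\{e_a\}_{a\in I}$ of $V$, such that the matrices $\{E_{a,x,y}\}$ (rows $a\in I$, columns $y$ with $(x,y)\in E$) are invertible for each $x\in\Sigma$ held fixed. A necessary and sufficient condition for the existence of a $V$-bein is that $E$ is fibred over $\Sigma$ (with fibres of cardinality $\dim V$), which implies in particular that $|E|=|\Sigma|\dim(V)$.
   Context: $\mathbb C[\Sigma]$ is the algebra of functions on $\Sigma$ with basis of delta-functions $\{\delta_x\}_{x\in\Sigma}$. A differential calculus on $M$ is a quotient bimodule of $\Omega^1M=\ker(M\otimes M\to M)$ (with $\mathrm df=1\otimes f-f\otimes1$); each corresponds to a subset $E\subseteq\Sigma\times\Sigma\setminus\mathrm{diagonal}$, with $\Omega^1(M)$ having basis $\{\delta_x\otimes\delta_y:(x,y)\in E\}$ (the $\delta_x\otimes\delta_y$ with $x\neq y$, $(x,y)\notin E$, are set to zero), and $(\mathrm df)_{x,y}=f_y-f_x$. $E$ is fibred over $\Sigma$ if the sets $F_x=\{y:(x,y)\in E\}$, $x\in\Sigma$, all have the same cardinality. A $V$-bein is a finite-dimensional right $H$-comodule $V$ with a linear map $e:V\to\Omega^1(M)$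 such that $M\otimes V\to\Omega^1(M)$, $m\otimes v\mapsto m\,e(v)$, is an isomorphism; $E_a=e(e_a)$. *)

theory Defs
  imports Complex_Main "HOL-Library.Poly_Mapping" "HOL-Library.Function_Algebras" "HOL-Library.FuncSet"
begin

section \<open>Complex vector spaces\<close>

class complex_vector = ab_group_add +
  fixes scaleC :: "complex \<Rightarrow> 'a \<Rightarrow> 'a"  (infixr \<open>*\<^sub>C\<close> 75)
  assumes scaleC_add_right: "c *\<^sub>C (x + y) = c *\<^sub>C x + c *\<^sub>C y"
    and scaleC_add_left: "(c + d) *\<^sub>C x = c *\<^sub>C x + d *\<^sub>C x"
    and scaleC_scaleC: "c *\<^sub>C (d *\<^sub>C x) = (c * d) *\<^sub>C x"
    and scaleC_one: "1 *\<^sub>C x = x"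

global_interpretation cvec: vector_space "scaleC :: complex \<Rightarrow> 'a \<Rightarrow> 'a::complex_vector"
  by unfold_locales (simp_all add: scaleC_add_right scaleC_add_left scaleC_scaleC scaleC_one)

global_interpretation cvec_pair: vector_space_pair
  "scaleC :: complex \<Rightarrow> 'a \<Rightarrow> 'a::complex_vector" "scaleC :: complex \<Rightarrow> 'b \<Rightarrow> 'b::complex_vector" ..

abbreviation clinear :: "('a::complex_vector \<Rightarrow> 'b::complex_vector) \<Rightarrow> bool" where
  "clinear \<equiv> Vector_Spaces.linear scaleC scaleC"

class complex_algebra_1 = complex_vector + ring_1 +
  assumes mult_scaleC_left: "(c *\<^sub>C x) * y = c *\<^sub>C (x * y)"
    and mult_scaleC_right: "x * (c *\<^sub>C y) = c *\<^sub>C (x * y)"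

instantiation complex :: complex_algebra_1
begin
definition scaleC_complex :: "complex \<Rightarrow> complex \<Rightarrow> complex" where "scaleC_complex c z = c * z"
instance by standard (simp_all add: scaleC_complex_def algebra_simps)
end

instantiation "fun" :: (type, complex_vector) complex_vector
begin
definition scaleC_fun :: "complex \<Rightarrow> ('a \<Rightarrow> 'b) \<Rightarrow> 'a \<Rightarrow> 'b" where "scaleC_fun c f = (\<lambda>x. c *\<^sub>C f x)"
instance by standard
  (simp_all add: scaleC_fun_def fun_eq_iff scaleC_add_right scaleC_add_left scaleC_scaleC scaleC_one)
end

instance "fun" :: (type, complex_algebra_1) complex_algebra_1
  by standard (simp_all add: scaleC_fun_def fun_eq_iff mult_scaleC_left mult_scaleC_right)

instantiation poly_mapping :: (type, complex_vector) complex_vector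
begin
definition scaleC_poly_mapping :: "complex \<Rightarrow> ('a \<Rightarrow>\<^sub>0 'b) \<Rightarrow> 'a \<Rightarrow>\<^sub>0 'b" where
  "scaleC_poly_mapping c p = Poly_Mapping.map (scaleC c) p"

lemma lookup_scaleC: "Poly_Mapping.lookup (c *\<^sub>C p) k = c *\<^sub>C Poly_Mapping.lookup p k"
  for p :: "'a \<Rightarrow>\<^sub>0 'b"
  by (simp add: scaleC_poly_mapping_def map.rep_eq when_def)

instance by standard
  (simp_all add: poly_mapping_eq_iff fun_eq_iff lookup_scaleC lookup_add
     scaleC_add_right scaleC_add_left scaleC_scaleC scaleC_one)
end

text \<open>Vector spaces with a carrier are subspaces \<open>V\<close> of a type of class
  \<^class>\<open>complex_vector\<close>. A linear map with domain \<open>V\<close> is \<^const>\<open>undefined\<close> outside \<open>V\<close>, so that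
  equality of such maps is equality on \<open>V\<close>.\<close>

definition lin_maps :: "'a::complex_vector set \<Rightarrow> 'b::complex_vector set \<Rightarrow> ('a \<Rightarrow> 'b) set" where
  "lin_maps V W = {f \<in> V \<rightarrow>\<^sub>E W. (\<forall>u\<in>V. \<forall>v\<in>V. f (u + v) = f u + f v) \<and>
                              (\<forall>c. \<forall>v\<in>V. f (c *\<^sub>C v) = c *\<^sub>C f v)}"

definition bilinear_on ::
  "'a::complex_vector set \<Rightarrow> 'b::complex_vector set \<Rightarrow> ('a \<Rightarrow> 'b \<Rightarrow> 'c::complex_vector) \<Rightarrow> bool" where
  "bilinear_on V W \<beta> \<longleftrightarrow>
     (\<forall>u\<in>V. \<forall>v\<in>V. \<forall>w\<in>W. \<beta> (u + v) w = \<beta> u w + \<beta> v w) \<and>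
     (\<forall>v\<in>V. \<forall>w\<in>W. \<forall>z\<in>W. \<beta> v (w + z) = \<beta> v w + \<beta> v z) \<and>
     (\<forall>c. \<forall>v\<in>V. \<forall>w\<in>W. \<beta> (c *\<^sub>C v) w = c *\<^sub>C \<beta> v w \<and> \<beta> v (c *\<^sub>C w) = c *\<^sub>C \<beta> v w)"

definition fin_dim :: "'a::complex_vector set \<Rightarrow> bool" where
  "fin_dim V \<longleftrightarrow> cvec.subspace V \<and> (\<exists>B. finite B \<and> cvec.span B = V)"

definition is_basis :: "'a::complex_vector set \<Rightarrow> 'i set \<Rightarrow> ('i \<Rightarrow> 'a) \<Rightarrow> bool" where
  "is_basis V I b \<longleftrightarrow> inj_on b I \<and> cvec.independent (b ` I) \<and> cvec.span (b ` I) = V"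

text \<open>Rows and columns have different index sets.\<close>

definition invertible_matrix :: "'i set \<Rightarrow> 'j set \<Rightarrow> ('i \<Rightarrow> 'j \<Rightarrow> complex) \<Rightarrow> bool" where
  "invertible_matrix I J A \<longleftrightarrow> (\<exists>B.
     (\<forall>i\<in>I. \<forall>i'\<in>I. (\<Sum>j\<in>J. A i j * B j i') = (if i = i' then 1 else 0)) \<and>
     (\<forall>j\<in>J. \<forall>j'\<in>J. (\<Sum>i\<in>I. B j i * A i j') = (if j = j' then 1 else 0)))"


section \<open>Tensor products\<close>

text \<open>The free complex vector space on \<open>'a \<times> 'b\<close> modulo bilinearity.\<close>

definition tensor_rels :: "(('a::complex_vector \<times> 'b::complex_vector) \<Rightarrow>\<^sub>0 complex) set" where
  "tensor_rels =
     {Poly_Mapping.single (a + a', b) 1 - Poly_Mapping.single (a, b) 1 - Poly_Mapping.single (a', b) 1 | a a' b. True} \<union>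
     {Poly_Mapping.single (a, b + b') 1 - Poly_Mapping.single (a, b) 1 - Poly_Mapping.single (a, b') 1 | a b b'. True} \<union>
     {Poly_Mapping.single (c *\<^sub>C a, b) 1 - c *\<^sub>C Poly_Mapping.single (a, b) 1 | a b c. True} \<union>
     {Poly_Mapping.single (a, c *\<^sub>C b) 1 - c *\<^sub>C Poly_Mapping.single (a, b) 1 | a b c. True}"

quotient_type (overloaded) ('a, 'b) tensor = "('a::complex_vector \<times> 'b::complex_vector) \<Rightarrow>\<^sub>0 complex" /
  "\<lambda>u v. u - v \<in> cvec.span tensor_rels"
proof (rule equivpI)
  show "reflp (\<lambda>u v::('a \<times> 'b) \<Rightarrow>\<^sub>0 complex. u - v \<in> cvec.span tensor_rels)"
    by (auto intro!: reflpI cvec.span_zero)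
  show "symp (\<lambda>u v::('a \<times> 'b) \<Rightarrow>\<^sub>0 complex. u - v \<in> cvec.span tensor_rels)"
    by (rule sympI) (metis cvec.span_neg minus_diff_eq)
  show "transp (\<lambda>u v::('a \<times> 'b) \<Rightarrow>\<^sub>0 complex. u - v \<in> cvec.span tensor_rels)"
  proof (rule transpI)
    fix u v w :: "('a \<times> 'b) \<Rightarrow>\<^sub>0 complex"
    assume "u - v \<in> cvec.span tensor_rels" "v - w \<in> cvec.span tensor_rels"
    from cvec.span_add[OF this] show "u - w \<in> cvec.span tensor_rels" by simp
  qed
qed

instantiation tensor :: (complex_vector, complex_vector) complex_vector
begin

lift_definition zero_tensor :: "('a, 'b) tensor" is 0 .

lift_definition plus_tensor :: "('a, 'b) tensor \<Rightarrow> ('a, 'b) tensor \<Rightarrow> ('a, 'b) tensor" is "(+)"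
  by (metis cvec.span_add add_diff_add)

lift_definition minus_tensor :: "('a, 'b) tensor \<Rightarrow> ('a, 'b) tensor \<Rightarrow> ('a, 'b) tensor" is "(-)"
proof -
  fix u u' v v' :: "('a \<times> 'b) \<Rightarrow>\<^sub>0 complex"
  assume "u - u' \<in> cvec.span tensor_rels" "v - v' \<in> cvec.span tensor_rels"
  from cvec.span_diff[OF this] show "(u - v) - (u' - v') \<in> cvec.span tensor_rels"
    by (simp add: algebra_simps)
qed

lift_definition uminus_tensor :: "('a, 'b) tensor \<Rightarrow> ('a, 'b) tensor" is uminus
  by (metis cvec.span_neg minus_diff_eq minus_diff_minus)

lift_definition scaleC_tensor :: "complex \<Rightarrow> ('a, 'b) tensor \<Rightarrow> ('a, 'b) tensor" is scaleC
  by (metis cvec.span_scale cvec.scale_right_diff_distrib)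

instance
proof
  fix a b c :: "('a, 'b) tensor" and r s :: complex
  show "a + b + c = a + (b + c)" by transfer (simp add: cvec.span_zero add.assoc)
  show "a + b = b + a" by transfer (simp add: cvec.span_zero add.commute)
  show "0 + a = a" by transfer (simp add: cvec.span_zero)
  show "- a + a = 0" by transfer (simp add: cvec.span_zero)
  show "a - b = a + - b" by transfer (simp add: cvec.span_zero)
  show "r *\<^sub>C (a + b) = r *\<^sub>C a + r *\<^sub>C b" by transfer (simp add: cvec.span_zero scaleC_add_right)
  show "(r + s) *\<^sub>C a = r *\<^sub>C a + s *\<^sub>C a" by transfer (simp add: cvec.span_zero scaleC_add_left)
  show "r *\<^sub>C (s *\<^sub>C a) = (r * s) *\<^sub>C a" by transfer (simp add: cvec.span_zero scaleC_scaleC)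
  show "1 *\<^sub>C a = a" by transfer (simp add: cvec.span_zero scaleC_one)
qed

end

lift_definition tensor_prod :: "'a::complex_vector \<Rightarrow> 'b::complex_vector \<Rightarrow> ('a, 'b) tensor"  (infixl \<open>\<otimes>\<close> 70)
  is "\<lambda>a b. Poly_Mapping.single (a, b) 1" .

text \<open>\<open>V \<otimes> W\<close> for subspaces \<open>V\<close>, \<open>W\<close>, inside the tensor product of the ambient types; see
  \<open>tensor_lift_unique\<close> below for its universal property.\<close>

definition tensor_space :: "'a::complex_vector set \<Rightarrow> 'b::complex_vector set \<Rightarrow> ('a, 'b) tensor set" where
  "tensor_space V W = cvec.span {v \<otimes> w | v w. v \<in> V \<and> w \<in> W}"

definition tensor_lift ::
  "'a::complex_vector set \<Rightarrow> 'b::complex_vector set \<Rightarrow> ('a \<Rightarrow> 'b \<Rightarrow> 'c::complex_vector) \<Rightarrow> ('a, 'b) tensor \<Rightarrow> 'c" where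
  "tensor_lift V W \<beta> =
     (THE f. f \<in> lin_maps (tensor_space V W) UNIV \<and> (\<forall>v\<in>V. \<forall>w\<in>W. f (v \<otimes> w) = \<beta> v w))"

definition tensor_map ::
  "'a::complex_vector set \<Rightarrow> 'b::complex_vector set \<Rightarrow> ('a \<Rightarrow> 'c::complex_vector) \<Rightarrow> ('b \<Rightarrow> 'd::complex_vector)
    \<Rightarrow> ('a, 'b) tensor \<Rightarrow> ('c, 'd) tensor" where
  "tensor_map V W f g = tensor_lift V W (\<lambda>v w. f v \<otimes> g w)"

definition tensor_assoc ::
  "(('a::complex_vector, 'b::complex_vector) tensor, 'c::complex_vector) tensor \<Rightarrow> ('a, ('b, 'c) tensor) tensor" where
  "tensor_assoc = tensor_lift UNIV UNIV (\<lambda>t c. tensor_lift UNIV UNIV (\<lambda>a b. a \<otimes> (b \<otimes> c)) t)"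

definition tensor_times ::
  "('a::complex_algebra_1, 'b::complex_algebra_1) tensor \<Rightarrow> ('a, 'b) tensor \<Rightarrow> ('a, 'b) tensor" where
  "tensor_times s t =
     tensor_lift UNIV UNIV (\<lambda>a b. tensor_lift UNIV UNIV (\<lambda>c d. (a * c) \<otimes> (b * d)) t) s"

subsection \<open>Universal property\<close>

lemma tensor_prod_add_left: "(a + a') \<otimes> b = a \<otimes> b + a' \<otimes> b"
  by transfer (rule cvec.span_base, unfold tensor_rels_def diff_diff_eq[symmetric], blast)

lemma tensor_prod_add_right: "a \<otimes> (b + b') = a \<otimes> b + a \<otimes> b'"
  by transfer (rule cvec.span_base, unfold tensor_rels_def diff_diff_eq[symmetric], blast)

lemma tensor_prod_scaleC_left: "(c *\<^sub>C a) \<otimes> b = c *\<^sub>C (a \<otimes> b)"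
  by transfer (rule cvec.span_base, unfold tensor_rels_def, blast)

lemma tensor_prod_scaleC_right: "a \<otimes> (c *\<^sub>C b) = c *\<^sub>C (a \<otimes> b)"
  by transfer (rule cvec.span_base, unfold tensor_rels_def, blast)

lemma bilinear_tensor_prod: "bilinear_on V W (\<otimes>)"
  by (simp add: bilinear_on_def tensor_prod_add_left tensor_prod_add_right
      tensor_prod_scaleC_left tensor_prod_scaleC_right)

lemma clinearI:
  assumes "\<And>x y. f (x + y) = f x + f y" "\<And>c x. f (c *\<^sub>C x) = c *\<^sub>C f x"
  shows "clinear f"
  by unfold_locales (simp_all add: assms)

lemma clinear_add: "clinear f \<Longrightarrow> f (x + y) = f x + f y"
  and clinear_scaleC: "clinear f \<Longrightarrow> f (c *\<^sub>C x) = c *\<^sub>C f x"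
  by (simp_all add: cvec_pair.linear_add cvec_pair.linear_scale)

definition free_lift :: "('k \<Rightarrow> 'c::complex_vector) \<Rightarrow> ('k \<Rightarrow>\<^sub>0 complex) \<Rightarrow> 'c" where
  "free_lift g u = (\<Sum>k\<in>Poly_Mapping.keys u. Poly_Mapping.lookup u k *\<^sub>C g k)"

lemma free_lift_superset:
  assumes "finite A" "Poly_Mapping.keys u \<subseteq> A"
  shows "free_lift g u = (\<Sum>k\<in>A. Poly_Mapping.lookup u k *\<^sub>C g k)"
  unfolding free_lift_def
  by (rule sum.mono_neutral_left) (use assms in \<open>auto simp: in_keys_iff\<close>)

lemma clinear_free_lift: "clinear (free_lift g)"
proof (rule clinearI)
  fix u v :: "'a \<Rightarrow>\<^sub>0 complex" and c :: complex
  let ?A = "Poly_Mapping.keys u \<union> Poly_Mapping.keys v"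
  have fin: "finite ?A" by simp
  have "Poly_Mapping.keys (u + v) \<subseteq> ?A" by (rule Poly_Mapping.keys_add)
  then show "free_lift g (u + v) = free_lift g u + free_lift g v"
    by (simp add: free_lift_superset[OF fin] lookup_add scaleC_add_left sum.distrib)
  have "Poly_Mapping.keys (c *\<^sub>C u) \<subseteq> Poly_Mapping.keys u"
    by (auto simp: in_keys_iff lookup_scaleC)
  then show "free_lift g (c *\<^sub>C u) = c *\<^sub>C free_lift g u"
    by (simp add: free_lift_superset[of "Poly_Mapping.keys u"] lookup_scaleC cvec.scale_sum_right
        scaleC_complex_def)
qed

lemma free_lift_single: "free_lift g (Poly_Mapping.single k 1) = g k"
  by (simp add: free_lift_def scaleC_one)

lemma free_lift_rels:
  assumes "bilinear_on UNIV UNIV \<beta>" "u \<in> cvec.span tensor_rels"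
  shows "free_lift (\<lambda>(a, b). \<beta> a b) u = 0"
proof -
  let ?L = "free_lift (\<lambda>(a, b). \<beta> a b)"
  note lin = clinear_free_lift[of "\<lambda>(a, b). \<beta> a b"]
  have "?L r = 0" if "r \<in> tensor_rels" for r
    using that assms(1) unfolding tensor_rels_def bilinear_on_def
    by (auto simp: cvec_pair.linear_diff[OF lin] clinear_scaleC[OF lin] free_lift_single)
  then show ?thesis
    using cvec_pair.linear_eq_0_on_span[OF lin _ assms(2)] by blast
qed

lemma tensor_lift_exists_UNIV:
  assumes "bilinear_on UNIV UNIV \<beta>"
  obtains f where "clinear f" "\<And>a b. f (a \<otimes> b) = \<beta> a b"
proof -
  let ?L = "free_lift (\<lambda>(a, b). \<beta> a b)"
  note lin = clinear_free_lift[of "\<lambda>(a, b). \<beta> a b"]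
  have cong: "?L u = ?L v" if "u - v \<in> cvec.span tensor_rels" for u v
    using free_lift_rels[OF assms that] by (simp add: cvec_pair.linear_diff[OF lin])
  define f where "f t = ?L (rep_tensor t)" for t
  have f: "f (abs_tensor u) = ?L u" for u
  proof -
    have "rep_tensor (abs_tensor u) - u \<in> cvec.span tensor_rels"
      by (metis tensor.abs_eq_iff Quotient3_abs_rep[OF Quotient3_tensor])
    then show ?thesis unfolding f_def by (rule cong)
  qed
  have abs_ex: "\<exists>u. t = abs_tensor u" for t :: "('a, 'b) tensor"
    using Quotient3_abs_rep[OF Quotient3_tensor] by metis
  have "clinear f"
  proof (rule clinearI)
    fix s t :: "('a, 'b) tensor" and c :: complex
    obtain u v where uv: "s = abs_tensor u" "t = abs_tensor v" using abs_ex by metis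
    show "f (s + t) = f s + f t"
      by (simp add: uv plus_tensor.abs_eq f clinear_add[OF lin])
    show "f (c *\<^sub>C s) = c *\<^sub>C f s"
      by (simp add: uv scaleC_tensor.abs_eq f clinear_scaleC[OF lin])
  qed
  moreover have "f (a \<otimes> b) = \<beta> a b" for a b
    by (simp add: tensor_prod.abs_eq f free_lift_single)
  ultimately show thesis by (rule that)
qed

lemma subspace_projection:
  fixes V :: "'a::complex_vector set"
  assumes "cvec.subspace V"
  obtains p where "clinear p" "\<And>a. p a \<in> V" "\<And>v. v \<in> V \<Longrightarrow> p v = v"
proof -
  have "\<exists>g. g ` UNIV \<subseteq> V \<and> clinear g \<and> (\<forall>v\<in>V. g (id v) = v)"
    by (rule cvec_pair.linear_exists_left_inverse_on) (use assms cvec.linear_id in \<open>auto simp: id_def\<close>)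
  then show thesis using that by (auto simp: image_subset_iff)
qed

theorem tensor_lift_unique:
  fixes \<beta> :: "'a::complex_vector \<Rightarrow> 'b::complex_vector \<Rightarrow> 'c::complex_vector"
  assumes V: "cvec.subspace V" and W: "cvec.subspace W" and \<beta>: "bilinear_on V W \<beta>"
  shows "\<exists>!f. f \<in> lin_maps (tensor_space V W) UNIV \<and> (\<forall>v\<in>V. \<forall>w\<in>W. f (v \<otimes> w) = \<beta> v w)"
proof -
  obtain p where p: "clinear p" "\<And>a. p a \<in> V" "\<And>v. v \<in> V \<Longrightarrow> p v = v"
    using subspace_projection[OF V] by metis
  obtain q where q: "clinear q" "\<And>a. q a \<in> W" "\<And>v. v \<in> W \<Longrightarrow> q v = v"
    using subspace_projection[OF W] by metis
  have "bilinear_on UNIV UNIV (\<lambda>a b. \<beta> (p a) (q b))"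
    using \<beta> p(2) q(2) unfolding bilinear_on_def
    by (simp add: clinear_add[OF p(1)] clinear_add[OF q(1)] clinear_scaleC[OF p(1)] clinear_scaleC[OF q(1)])
  then obtain f where f: "clinear f" "\<And>a b. f (a \<otimes> b) = \<beta> (p a) (q b)"
    using tensor_lift_exists_UNIV by blast
  let ?T = "tensor_space V W"
  have sub: "cvec.subspace ?T" unfolding tensor_space_def by (rule cvec.subspace_span)
  have mem: "v \<otimes> w \<in> ?T" if "v \<in> V" "w \<in> W" for v w
    unfolding tensor_space_def by (rule cvec.span_base) (use that in blast)
  have "restrict f ?T \<in> lin_maps ?T UNIV \<and> (\<forall>v\<in>V. \<forall>w\<in>W. restrict f ?T (v \<otimes> w) = \<beta> v w)"
    using mem p(3) q(3)
    by (auto simp: lin_maps_def f(2) clinear_add[OF f(1)] clinear_scaleC[OF f(1)]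
        cvec.subspace_add[OF sub] cvec.subspace_scale[OF sub])
  moreover have "g = h"
    if g: "g \<in> lin_maps ?T UNIV \<and> (\<forall>v\<in>V. \<forall>w\<in>W. g (v \<otimes> w) = \<beta> v w)"
      and h: "h \<in> lin_maps ?T UNIV \<and> (\<forall>v\<in>V. \<forall>w\<in>W. h (v \<otimes> w) = \<beta> v w)" for g h
  proof -
    have zero: "k 0 = 0" if "k \<in> lin_maps ?T UNIV" for k :: "('a, 'b) tensor \<Rightarrow> 'c"
    proof -
      have "k (0 *\<^sub>C 0) = 0 *\<^sub>C k 0"
        using that cvec.subspace_0[OF sub] unfolding lin_maps_def by blast
      then show ?thesis by simp
    qed
    have "g t = h t \<and> t \<in> ?T" if "t \<in> ?T" for t
      using that unfolding tensor_space_def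
    proof (induction rule: cvec.span_induct_alt)
      case base
      then show ?case using zero[OF conjunct1[OF g]] zero[OF conjunct1[OF h]] by (simp add: cvec.span_zero)
    next
      case (step c x y)
      from step(1) obtain v w where x: "x = v \<otimes> w" "v \<in> V" "w \<in> W" by blast
      have mems: "x \<in> ?T" "y \<in> ?T" using step mem x by (auto simp: tensor_space_def)
      have cx: "c *\<^sub>C x \<in> ?T" by (rule cvec.subspace_scale[OF sub mems(1)])
      have "g (c *\<^sub>C x + y) = c *\<^sub>C g x + g y" "h (c *\<^sub>C x + y) = c *\<^sub>C h x + h y"
        using g h mems cx by (auto simp: lin_maps_def)
      moreover have "g x = h x" using g h x by simp
      ultimately show ?case
        using step cvec.subspace_add[OF sub cx mems(2)] by (simp add: tensor_space_def)
    qed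
    then show ?thesis
      using g h by (intro PiE_ext[of g ?T "\<lambda>_. UNIV" h]) (auto simp: lin_maps_def)
  qed
  ultimately show ?thesis by blast
qed

corollary tensor_lift:
  assumes "cvec.subspace V" "cvec.subspace W" "bilinear_on V W \<beta>"
  shows tensor_lift_in: "tensor_lift V W \<beta> \<in> lin_maps (tensor_space V W) UNIV"
    and tensor_lift_apply: "\<And>v w. v \<in> V \<Longrightarrow> w \<in> W \<Longrightarrow> tensor_lift V W \<beta> (v \<otimes> w) = \<beta> v w"
  using theI'[OF tensor_lift_unique[OF assms]] unfolding tensor_lift_def by blast+


section \<open>Hopf algebras and comodules\<close>

locale hopf_algebra =
  fixes comult :: "'h::complex_algebra_1 \<Rightarrow> ('h, 'h) tensor"
    and counit :: "'h \<Rightarrow> complex"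
    and antipode :: "'h \<Rightarrow> 'h"
  assumes comult_linear: "clinear comult"
    and counit_linear: "clinear counit"
    and antipode_linear: "clinear antipode"
    and coassoc: "tensor_assoc (tensor_map UNIV UNIV comult id (comult h))
                    = tensor_map UNIV UNIV id comult (comult h)"
    and counit_left: "tensor_lift UNIV UNIV (\<lambda>a b. counit a *\<^sub>C b) (comult h) = h"
    and counit_right: "tensor_lift UNIV UNIV (\<lambda>a b. counit b *\<^sub>C a) (comult h) = h"
    and comult_mult: "comult (g * h) = tensor_times (comult g) (comult h)"
    and comult_one: "comult 1 = 1 \<otimes> 1"
    and counit_mult: "counit (g * h) = counit g * counit h"
    and counit_one: "counit 1 = 1"
    and antipode_left: "tensor_lift UNIV UNIV (\<lambda>a b. antipode a * b) (comult h) = counit h *\<^sub>C 1"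
    and antipode_right: "tensor_lift UNIV UNIV (\<lambda>a b. a * antipode b) (comult h) = counit h *\<^sub>C 1"

definition right_comodule ::
  "('h::complex_algebra_1 \<Rightarrow> ('h, 'h) tensor) \<Rightarrow> ('h \<Rightarrow> complex)
    \<Rightarrow> 'v::complex_vector set \<Rightarrow> ('v \<Rightarrow> ('v, 'h) tensor) \<Rightarrow> bool" where
  "right_comodule comult counit V \<rho> \<longleftrightarrow>
     cvec.subspace V \<and> \<rho> \<in> lin_maps V (tensor_space V UNIV) \<and>
     (\<forall>v\<in>V. tensor_assoc (tensor_map V UNIV \<rho> id (\<rho> v)) = tensor_map V UNIV id comult (\<rho> v)) \<and>
     (\<forall>v\<in>V. tensor_lift V UNIV (\<lambda>w h. counit h *\<^sub>C w) (\<rho> v) = v)"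


section \<open>Differential calculi on a finite set\<close>

text \<open>Functions on \<open>\<Sigma>\<close> are functions on the ambient type that vanish outside \<open>\<Sigma>\<close>; their product is
  the pointwise one.\<close>

definition functions_on :: "'s set \<Rightarrow> ('s \<Rightarrow> complex) set" where
  "functions_on \<Sigma> = {f. \<forall>x. x \<notin> \<Sigma> \<longrightarrow> f x = 0}"

definition delta :: "'s \<Rightarrow> 's \<Rightarrow> complex" where
  "delta x = (\<lambda>y. if y = x then 1 else 0)"

definition lact :: "('s \<Rightarrow> complex) \<Rightarrow> ('s \<Rightarrow> complex, 'b::complex_vector) tensor \<Rightarrow> ('s \<Rightarrow> complex, 'b) tensor" where
  "lact m = tensor_map UNIV UNIV (\<lambda>f. m * f) id"

definition ract :: "('a::complex_vector, 's \<Rightarrow> complex) tensor \<Rightarrow> ('s \<Rightarrow> complex) \<Rightarrow> ('a, 's \<Rightarrow> complex) tensor" where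
  "ract \<omega> m = tensor_map UNIV UNIV id (\<lambda>f. f * m) \<omega>"

text \<open>The quotient of the universal calculus that sets \<open>\<delta>\<^sub>x \<otimes> \<delta>\<^sub>y\<close> to zero for \<open>(x, y) \<notin> E\<close> is
  identified with the span of the remaining \<open>\<delta>\<^sub>x \<otimes> \<delta>\<^sub>y\<close>, which is a complementary subbimodule; the
  quotient map becomes \<open>calculus_proj\<close> (see \<open>calculus_quotient\<close>).\<close>

definition omega1 :: "('s \<times> 's) set \<Rightarrow> ('s \<Rightarrow> complex, 's \<Rightarrow> complex) tensor set" where
  "omega1 E = cvec.span {delta x \<otimes> delta y | x y. (x, y) \<in> E}"

definition universal_omega1 :: "'s set \<Rightarrow> ('s \<Rightarrow> complex, 's \<Rightarrow> complex) tensor set" where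
  "universal_omega1 \<Sigma> =
     {t \<in> tensor_space (functions_on \<Sigma>) (functions_on \<Sigma>).
        tensor_lift (functions_on \<Sigma>) (functions_on \<Sigma>) (*) t = 0}"

definition calculus_proj ::
  "('s \<times> 's) set \<Rightarrow> ('s \<Rightarrow> complex, 's \<Rightarrow> complex) tensor \<Rightarrow> ('s \<Rightarrow> complex, 's \<Rightarrow> complex) tensor" where
  "calculus_proj E = tensor_lift UNIV UNIV (\<lambda>f g. \<Sum>(x, y)\<in>E. (f x * g y) *\<^sub>C (delta x \<otimes> delta y))"

text \<open>The unit of \<open>\<complex>[\<Sigma>]\<close> is the indicator function of \<open>\<Sigma>\<close>.\<close>

definition ext_d ::
  "'s set \<Rightarrow> ('s \<times> 's) set \<Rightarrow> ('s \<Rightarrow> complex) \<Rightarrow> ('s \<Rightarrow> complex, 's \<Rightarrow> complex) tensor" where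
  "ext_d \<Sigma> E f = calculus_proj E ((\<lambda>x. of_bool (x \<in> \<Sigma>)) \<otimes> f - f \<otimes> (\<lambda>x. of_bool (x \<in> \<Sigma>)))"

definition fibre :: "('s \<times> 's) set \<Rightarrow> 's \<Rightarrow> 's set" where
  "fibre E x = {y. (x, y) \<in> E}"

definition fibred_over :: "'s set \<Rightarrow> ('s \<times> 's) set \<Rightarrow> bool" where
  "fibred_over \<Sigma> E \<longleftrightarrow> (\<forall>x\<in>\<Sigma>. \<forall>x'\<in>\<Sigma>. card (fibre E x) = card (fibre E x'))"

subsection \<open>The quotient of the universal calculus\<close>

lemma tensor_space_UNIV: "tensor_space UNIV UNIV = UNIV"
proof -
  have "t \<in> tensor_space UNIV UNIV" for t :: "('a::complex_vector, 'b::complex_vector) tensor"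
  proof -
    obtain u where u: "t = abs_tensor u"
      using Quotient3_abs_rep[OF Quotient3_tensor] by metis
    have lin: "clinear (abs_tensor :: _ \<Rightarrow> ('a, 'b) tensor)"
      by (rule clinearI) (simp_all add: plus_tensor.abs_eq scaleC_tensor.abs_eq)
    have "u = (\<Sum>k\<in>Poly_Mapping.keys u. Poly_Mapping.lookup u k *\<^sub>C Poly_Mapping.single k 1)"
      by (rule poly_mapping_eqI)
        (simp add: lookup_sum lookup_scaleC scaleC_complex_def lookup_single when_def if_distrib[of "times _"] in_keys_iff cong: if_cong)
    from arg_cong[OF this, of abs_tensor]
    have "t = (\<Sum>k\<in>Poly_Mapping.keys u. Poly_Mapping.lookup u k *\<^sub>C abs_tensor (Poly_Mapping.single k 1))"
      unfolding cvec_pair.linear_sum[OF lin] clinear_scaleC[OF lin] u .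
    moreover have "abs_tensor (Poly_Mapping.single k 1) \<in> tensor_space UNIV UNIV" for k :: "'a \<times> 'b"
      unfolding tensor_space_def
      by (rule cvec.span_base) (metis (mono_tags, lifting) UNIV_I mem_Collect_eq surj_pair tensor_prod.abs_eq)
    ultimately show ?thesis
      unfolding tensor_space_def by (simp add: cvec.span_sum cvec.span_scale)
  qed
  then show ?thesis by blast
qed

lemma tensor_lift_UNIV:
  assumes "bilinear_on UNIV UNIV \<beta>"
  shows clinear_tensor_lift: "clinear (tensor_lift UNIV UNIV \<beta>)"
    and tensor_lift_UNIV_apply: "tensor_lift UNIV UNIV \<beta> (a \<otimes> b) = \<beta> a b"
  using tensor_lift_in[OF cvec.subspace_UNIV cvec.subspace_UNIV assms]
    tensor_lift_apply[OF cvec.subspace_UNIV cvec.subspace_UNIV assms]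
  by (auto simp: lin_maps_def tensor_space_UNIV intro!: clinearI)

lemma clinear_eq_on_tensor_space:
  assumes "clinear f" "clinear g" "\<And>v w. v \<in> V \<Longrightarrow> w \<in> W \<Longrightarrow> f (v \<otimes> w) = g (v \<otimes> w)"
    and "t \<in> tensor_space V W"
  shows "f t = g t"
  using assms(4) unfolding tensor_space_def
  by (rule cvec_pair.linear_eq_on_span[OF assms(1,2), rotated]) (use assms(3) in auto)

lemma clinear_eq_on_tensor:
  assumes "clinear f" "clinear g" "\<And>v w. f (v \<otimes> w) = g (v \<otimes> w)"
  shows "f t = g t"
  by (rule clinear_eq_on_tensor_space[of f g UNIV UNIV]) (use assms in \<open>simp_all add: tensor_space_UNIV\<close>)

definition coef :: "('s \<Rightarrow> complex, 's \<Rightarrow> complex) tensor \<Rightarrow> 's \<Rightarrow> 's \<Rightarrow> complex" where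
  "coef t x y = tensor_lift UNIV UNIV (\<lambda>f g. f x * g y) t"

lemma clinear_coef: "clinear (\<lambda>t. coef t x y)"
  and coef_tensor_prod [simp]: "coef (f \<otimes> g) x y = f x * g y"
proof -
  have "bilinear_on UNIV UNIV (\<lambda>f g. f x * g y :: complex)"
    by (simp add: bilinear_on_def scaleC_fun_def scaleC_complex_def algebra_simps)
  from tensor_lift_UNIV[OF this] show "clinear (\<lambda>t. coef t x y)" "coef (f \<otimes> g) x y = f x * g y"
    unfolding coef_def by simp_all
qed

lemma clinear_sum_coef: "clinear (\<lambda>t. \<Sum>(x, y)\<in>A. coef t x y *\<^sub>C (delta x \<otimes> delta y))"
  by (rule clinearI)
    (simp_all add: clinear_add[OF clinear_coef] clinear_scaleC[OF clinear_coef] scaleC_add_left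
      sum.distrib case_prod_unfold cvec.scale_sum_right scaleC_complex_def)

lemma calculus_proj:
  shows clinear_calculus_proj: "clinear (calculus_proj A)"
    and calculus_proj_tensor_prod:
      "calculus_proj A (f \<otimes> g) = (\<Sum>(x, y)\<in>A. (f x * g y) *\<^sub>C (delta x \<otimes> delta y))"
proof -
  have "bilinear_on UNIV UNIV (\<lambda>f g. \<Sum>(x, y)\<in>A. (f x * g y) *\<^sub>C (delta x \<otimes> delta y))"
    by (simp add: bilinear_on_def scaleC_fun_def scaleC_complex_def ring_distribs scaleC_add_left
        sum.distrib case_prod_unfold cvec.scale_sum_right mult.assoc mult.left_commute)
  from tensor_lift_UNIV[OF this] show "clinear (calculus_proj A)"
    "calculus_proj A (f \<otimes> g) = (\<Sum>(x, y)\<in>A. (f x * g y) *\<^sub>C (delta x \<otimes> delta y))"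
    unfolding calculus_proj_def by simp_all
qed

lemma calculus_proj_coef:
  "calculus_proj A t = (\<Sum>(x, y)\<in>A. coef t x y *\<^sub>C (delta x \<otimes> delta y))"
  by (rule clinear_eq_on_tensor[OF clinear_calculus_proj clinear_sum_coef])
    (simp add: calculus_proj_tensor_prod)

lemma coef_delta: "coef (delta x \<otimes> delta y) x' y' = (if x = x' \<and> y = y' then 1 else 0)"
  by (auto simp: delta_def)

lemma calculus_proj_delta:
  assumes "finite A"
  shows "calculus_proj A (delta x \<otimes> delta y) = (if (x, y) \<in> A then delta x \<otimes> delta y else 0)"
proof -
  have "calculus_proj A (delta x \<otimes> delta y)
      = (\<Sum>p\<in>A. if p = (x, y) then delta x \<otimes> delta y else 0)"
    unfolding calculus_proj_coef
    by (rule sum.cong) (auto simp: coef_delta scaleC_one case_prod_unfold prod_eq_iff simp del: coef_tensor_prod)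
  then show ?thesis using assms by simp
qed

lemma subspace_functions_on: "cvec.subspace (functions_on \<Sigma>)"
  by (auto simp: cvec.subspace_def functions_on_def scaleC_fun_def scaleC_complex_def)

lemma bilinear_times: "bilinear_on V W ((*) :: ('s \<Rightarrow> complex) \<Rightarrow> _)"
  by (simp add: bilinear_on_def fun_eq_iff scaleC_fun_def scaleC_complex_def algebra_simps)

lemma calculus_proj_id:
  assumes "finite \<Sigma>" "t \<in> tensor_space (functions_on \<Sigma>) (functions_on \<Sigma>)"
  shows "calculus_proj (\<Sigma> \<times> \<Sigma>) t = t"
proof (rule clinear_eq_on_tensor_space[OF clinear_calculus_proj _ _ assms(2)])
  show "clinear (\<lambda>t :: ('a \<Rightarrow> complex, 'a \<Rightarrow> complex) tensor. t)" by (rule clinearI) simp_all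
  fix f g :: "'a \<Rightarrow> complex" assume "f \<in> functions_on \<Sigma>" "g \<in> functions_on \<Sigma>"
  have expand: "h = (\<Sum>x\<in>\<Sigma>. h x *\<^sub>C delta x)" if "h \<in> functions_on \<Sigma>" for h
  proof
    fix z
    have "(\<Sum>x\<in>\<Sigma>. h x *\<^sub>C delta x) z = (\<Sum>x\<in>\<Sigma>. h x * delta x z)"
      by (induction \<Sigma> rule: infinite_finite_induct) (simp_all add: scaleC_fun_def scaleC_complex_def)
    also have "\<dots> = h z"
      using that assms(1) by (auto simp: delta_def functions_on_def if_distrib[of "times _"] cong: if_cong)
    finally show "h z = (\<Sum>x\<in>\<Sigma>. h x *\<^sub>C delta x) z" ..
  qed
  have l: "clinear (\<lambda>f. f \<otimes> g)" for g :: "'a \<Rightarrow> complex"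
    by (rule clinearI) (simp_all add: tensor_prod_add_left tensor_prod_scaleC_left)
  have r: "clinear (\<lambda>g. f \<otimes> g)" for f :: "'a \<Rightarrow> complex"
    by (rule clinearI) (simp_all add: tensor_prod_add_right tensor_prod_scaleC_right)
  have "f \<otimes> g = (\<Sum>x\<in>\<Sigma>. f x *\<^sub>C delta x) \<otimes> (\<Sum>y\<in>\<Sigma>. g y *\<^sub>C delta y)"
    using expand \<open>f \<in> _\<close> \<open>g \<in> _\<close> by metis
  also have "\<dots> = (\<Sum>x\<in>\<Sigma>. \<Sum>y\<in>\<Sigma>. (f x * g y) *\<^sub>C (delta x \<otimes> delta y))"
    by (simp add: cvec_pair.linear_sum[OF l] cvec_pair.linear_sum[OF r]
        tensor_prod_scaleC_left tensor_prod_scaleC_right cvec.scale_sum_right, subst sum.swap)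
      (simp add: mult.commute)
  also have "\<dots> = calculus_proj (\<Sigma> \<times> \<Sigma>) (f \<otimes> g)"
    by (simp add: calculus_proj_tensor_prod sum.cartesian_product)
  finally show "calculus_proj (\<Sigma> \<times> \<Sigma>) (f \<otimes> g) = f \<otimes> g" ..
qed

lemma universal_omega1_iff:
  "t \<in> universal_omega1 \<Sigma> \<longleftrightarrow>
     t \<in> tensor_space (functions_on \<Sigma>) (functions_on \<Sigma>) \<and> (\<forall>x. coef t x x = 0)"
proof -
  let ?M = "functions_on \<Sigma>"
  let ?m = "tensor_lift UNIV UNIV ((*) :: ('a \<Rightarrow> complex) \<Rightarrow> _)"
  note m = tensor_lift_UNIV[OF bilinear_times]
  have "tensor_lift ?M ?M (*) t = ?m t" if "t \<in> tensor_space ?M ?M"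
  proof -
    have sub: "cvec.subspace (tensor_space ?M ?M)"
      unfolding tensor_space_def by (rule cvec.subspace_span)
    have mem: "f \<otimes> g \<in> tensor_space ?M ?M" if "f \<in> ?M" "g \<in> ?M" for f g
      unfolding tensor_space_def by (rule cvec.span_base) (use that in blast)
    have "restrict ?m (tensor_space ?M ?M) \<in> lin_maps (tensor_space ?M ?M) UNIV \<and>
        (\<forall>f\<in>?M. \<forall>g\<in>?M. restrict ?m (tensor_space ?M ?M) (f \<otimes> g) = f * g)"
      using mem by (auto simp: lin_maps_def m(2) clinear_add[OF m(1)] clinear_scaleC[OF m(1)]
          cvec.subspace_add[OF sub] cvec.subspace_scale[OF sub])
    then have "tensor_lift ?M ?M (*) = restrict ?m (tensor_space ?M ?M)"
      unfolding tensor_lift_def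
      by (rule the1_equality[OF tensor_lift_unique[OF subspace_functions_on subspace_functions_on bilinear_times]])
    then show ?thesis using that by simp
  qed
  moreover have "?m t x = coef t x x" for x
  proof (rule clinear_eq_on_tensor[OF _ clinear_coef])
    show "clinear (\<lambda>t. ?m t x)"
      by (rule clinearI)
        (simp_all add: clinear_add[OF m(1)] clinear_scaleC[OF m(1)] scaleC_fun_def)
    show "?m (f \<otimes> g) x = coef (f \<otimes> g) x x" for f g :: "'a \<Rightarrow> complex"
      unfolding m(2) coef_tensor_prod by simp
  qed
  ultimately show ?thesis
    unfolding universal_omega1_def by (auto simp: fun_eq_iff)
qed

lemma delta_universal:
  assumes "x \<in> \<Sigma>" "y \<in> \<Sigma>" "x \<noteq> y"
  shows "delta x \<otimes> delta y \<in> universal_omega1 \<Sigma>"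
proof -
  have "delta x \<in> functions_on \<Sigma>" "delta y \<in> functions_on \<Sigma>"
    using assms by (auto simp: delta_def functions_on_def)
  then have "delta x \<otimes> delta y \<in> tensor_space (functions_on \<Sigma>) (functions_on \<Sigma>)"
    unfolding tensor_space_def by (intro cvec.span_base) blast
  then show ?thesis using assms by (auto simp: universal_omega1_iff delta_def)
qed

lemma subspace_universal: "cvec.subspace (universal_omega1 \<Sigma>)"
proof -
  have sub: "cvec.subspace (tensor_space (functions_on \<Sigma>) (functions_on \<Sigma>))"
    unfolding tensor_space_def by (rule cvec.subspace_span)
  show ?thesis
    unfolding cvec.subspace_def universal_omega1_iff
    using cvec.subspace_0[OF sub] cvec.subspace_add[OF sub] cvec.subspace_scale[OF sub]
    by (simp add: universal_omega1_iff clinear_add[OF clinear_coef] clinear_scaleC[OF clinear_coef]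
        cvec_pair.linear_0[OF clinear_coef])
qed

lemma calculus_proj_omega1: "calculus_proj E t \<in> omega1 E"
  unfolding calculus_proj_coef omega1_def
  by (rule cvec.span_sum, clarify, rule cvec.span_scale, rule cvec.span_base, blast)

theorem calculus_quotient:
  assumes "finite \<Sigma>" "E \<subseteq> \<Sigma> \<times> \<Sigma> - Id"
  shows "clinear (calculus_proj E)"
    and "calculus_proj E ` universal_omega1 \<Sigma> = omega1 E"
    and "{t \<in> universal_omega1 \<Sigma>. calculus_proj E t = 0} =
           cvec.span {delta x \<otimes> delta y | x y. x \<in> \<Sigma> \<and> y \<in> \<Sigma> \<and> x \<noteq> y \<and> (x, y) \<notin> E}"
      (is "?K = cvec.span ?N")
    and "calculus_proj E (lact m t) = lact m (calculus_proj E t)"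
    and "calculus_proj E (ract t m) = ract (calculus_proj E t) m"
    and "ext_d \<Sigma> E f = (\<Sum>(x, y)\<in>E. (f y - f x) *\<^sub>C (delta x \<otimes> delta y))"
proof -
  note lin = clinear_calculus_proj[of E]
  have finE: "finite E" using assms by (meson finite_Diff finite_SigmaI finite_subset)
  show "clinear (calculus_proj E)" by (rule lin)
  show "calculus_proj E ` universal_omega1 \<Sigma> = omega1 E"
  proof
    show "calculus_proj E ` universal_omega1 \<Sigma> \<subseteq> omega1 E" using calculus_proj_omega1 by blast
    show "omega1 E \<subseteq> calculus_proj E ` universal_omega1 \<Sigma>"
    proof
      fix w assume w: "w \<in> omega1 E"
      have "omega1 E \<subseteq> universal_omega1 \<Sigma>"
        unfolding omega1_def
        by (rule cvec.span_minimal[OF _ subspace_universal]) (use assms(2) in \<open>auto intro!: delta_universal\<close>)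
      moreover have "calculus_proj E w = w"
      proof (rule cvec_pair.linear_eq_on_span[OF lin])
        show "clinear (\<lambda>t :: ('a \<Rightarrow> complex, 'a \<Rightarrow> complex) tensor. t)" by (rule clinearI) simp_all
        show "w \<in> cvec.span {delta x \<otimes> delta y | x y. (x, y) \<in> E}" using w unfolding omega1_def .
      qed (auto simp: calculus_proj_delta[OF finE])
      ultimately show "w \<in> calculus_proj E ` universal_omega1 \<Sigma>" using w by (metis image_eqI subsetD)
    qed
  qed
  show "?K = cvec.span ?N"
  proof
    show "?K \<subseteq> cvec.span ?N"
    proof
      fix t assume t: "t \<in> ?K"
      then have "t \<in> tensor_space (functions_on \<Sigma>) (functions_on \<Sigma>)" and diag: "coef t x x = 0" for x
        by (auto simp: universal_omega1_iff)
      then have "t = calculus_proj (\<Sigma> \<times> \<Sigma>) t" using calculus_proj_id[OF assms(1)] by metis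
      also have "\<dots> = calculus_proj (\<Sigma> \<times> \<Sigma> - E) t + calculus_proj E t"
        unfolding calculus_proj_coef
        by (rule sum.subset_diff) (use assms in auto)
      also have "\<dots> = calculus_proj (\<Sigma> \<times> \<Sigma> - E) t" using t by simp
      also have "\<dots> \<in> cvec.span ?N"
        unfolding calculus_proj_coef
      proof (rule cvec.span_sum, clarify)
        fix x y assume "(x, y) \<notin> E" "x \<in> \<Sigma>" "y \<in> \<Sigma>"
        then show "coef t x y *\<^sub>C (delta x \<otimes> delta y) \<in> cvec.span ?N"
          by (cases "x = y") (simp add: diag cvec.span_zero, rule cvec.span_scale, rule cvec.span_base, blast)
      qed
      finally show "t \<in> cvec.span ?N" .
    qed
    have "calculus_proj E t = 0" if "t \<in> cvec.span ?N" for t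
      by (rule cvec_pair.linear_eq_0_on_span[OF lin _ that])
        (auto simp: calculus_proj_delta[OF finE])
    moreover have "cvec.span ?N \<subseteq> universal_omega1 \<Sigma>"
      by (rule cvec.span_minimal[OF _ subspace_universal]) (auto intro!: delta_universal)
    ultimately show "cvec.span ?N \<subseteq> ?K" by blast
  qed
  have lact: "clinear (lact m :: (_, 'a \<Rightarrow> complex) tensor \<Rightarrow> _)" "lact m (f \<otimes> g) = (m * f) \<otimes> g"
    for f g :: "'a \<Rightarrow> complex"
  proof -
    have "bilinear_on UNIV UNIV (\<lambda>f (g :: 'a \<Rightarrow> complex). (m * f) \<otimes> id g)"
      by (simp add: bilinear_on_def tensor_prod_add_left tensor_prod_add_right tensor_prod_scaleC_left
          tensor_prod_scaleC_right mult_scaleC_left mult_scaleC_right distrib_left distrib_right)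
    from tensor_lift_UNIV[OF this] show "clinear (lact m :: (_, 'a \<Rightarrow> complex) tensor \<Rightarrow> _)" "lact m (f \<otimes> g) = (m * f) \<otimes> g"
      unfolding lact_def tensor_map_def by simp_all
  qed
  have ract: "clinear (\<lambda>t :: ('a \<Rightarrow> complex, _) tensor. ract t m)" "ract (f \<otimes> g) m = f \<otimes> (g * m)"
    for f g :: "'a \<Rightarrow> complex"
  proof -
    have "bilinear_on UNIV UNIV (\<lambda>(f :: 'a \<Rightarrow> complex) g. id f \<otimes> (g * m))"
      by (simp add: bilinear_on_def tensor_prod_add_left tensor_prod_add_right tensor_prod_scaleC_left
          tensor_prod_scaleC_right mult_scaleC_left mult_scaleC_right distrib_left distrib_right)
    from tensor_lift_UNIV[OF this] show "clinear (\<lambda>t :: ('a \<Rightarrow> complex, _) tensor. ract t m)" "ract (f \<otimes> g) m = f \<otimes> (g * m)"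
      unfolding ract_def tensor_map_def by simp_all
  qed
  have mdelta: "m * delta x = m x *\<^sub>C delta x" "delta x * m = m x *\<^sub>C delta x" for x
    by (auto simp: fun_eq_iff delta_def scaleC_fun_def scaleC_complex_def)
  show "calculus_proj E (lact m t) = lact m (calculus_proj E t)"
  proof (rule clinear_eq_on_tensor[where f = "\<lambda>t. calculus_proj E (lact m t)" and g = "\<lambda>t. lact m (calculus_proj E t)"])
    show "clinear (\<lambda>t. calculus_proj E (lact m t))" "clinear (\<lambda>t. lact m (calculus_proj E t))"
      using Vector_Spaces.linear_compose[OF lact(1) lin] Vector_Spaces.linear_compose[OF lin lact(1)]
      by (simp_all add: comp_def)
  qed (simp add: lact calculus_proj_tensor_prod cvec_pair.linear_sum[OF lact(1)] case_prod_unfold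
        clinear_scaleC[OF lact(1)] mdelta tensor_prod_scaleC_left mult_ac)
  show "calculus_proj E (ract t m) = ract (calculus_proj E t) m"
  proof (rule clinear_eq_on_tensor[where f = "\<lambda>t. calculus_proj E (ract t m)" and g = "\<lambda>t. ract (calculus_proj E t) m"])
    show "clinear (\<lambda>t. calculus_proj E (ract t m))" "clinear (\<lambda>t. ract (calculus_proj E t) m)"
      using Vector_Spaces.linear_compose[OF ract(1) lin] Vector_Spaces.linear_compose[OF lin ract(1)]
      by (simp_all add: comp_def)
  qed (simp add: ract calculus_proj_tensor_prod cvec_pair.linear_sum[OF ract(1)] case_prod_unfold
        clinear_scaleC[OF ract(1)] mdelta tensor_prod_scaleC_right mult_ac)
  show "ext_d \<Sigma> E f = (\<Sum>(x, y)\<in>E. (f y - f x) *\<^sub>C (delta x \<otimes> delta y))"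
    unfolding ext_d_def cvec_pair.linear_diff[OF lin] calculus_proj_tensor_prod sum_subtractf[symmetric]
  proof (rule sum.cong[OF refl], clarify)
    fix x y assume "(x, y) \<in> E"
    then have "x \<in> \<Sigma>" "y \<in> \<Sigma>" using assms(2) by auto
    then show "(of_bool (x \<in> \<Sigma>) * f y) *\<^sub>C (delta x \<otimes> delta y) - (f x * of_bool (y \<in> \<Sigma>)) *\<^sub>C (delta x \<otimes> delta y)
        = (f y - f x) *\<^sub>C (delta x \<otimes> delta y)"
      by (simp add: cvec.scale_left_diff_distrib)
  qed
qed

section \<open>Beins\<close>

definition vbein ::
  "('h::complex_algebra_1 \<Rightarrow> ('h, 'h) tensor) \<Rightarrow> ('h \<Rightarrow> complex) \<Rightarrow> 's set \<Rightarrow> ('s \<times> 's) set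
    \<Rightarrow> 'v::complex_vector set \<Rightarrow> ('v \<Rightarrow> ('v, 'h) tensor)
    \<Rightarrow> ('v \<Rightarrow> ('s \<Rightarrow> complex, 's \<Rightarrow> complex) tensor) \<Rightarrow> bool" where
  "vbein comult counit \<Sigma> E V \<rho> e \<longleftrightarrow>
     fin_dim V \<and> right_comodule comult counit V \<rho> \<and> e \<in> lin_maps V (omega1 E) \<and>
     bij_betw (tensor_lift (functions_on \<Sigma>) V (\<lambda>m v. lact m (e v)))
       (tensor_space (functions_on \<Sigma>) V) (omega1 E)"

text \<open>Families of 1-forms \<open>E\<^sub>a\<close>, \<open>a \<in> I\<close>, with invertible coefficient matrices; \<open>c a x y\<close> is
  \<open>E\<^bsub>a,x,y\<^esub>\<close>.\<close>

definition bein_forms ::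
  "'s set \<Rightarrow> ('s \<times> 's) set \<Rightarrow> 'i set \<Rightarrow> ('i \<Rightarrow> ('s \<Rightarrow> complex, 's \<Rightarrow> complex) tensor) set" where
  "bein_forms \<Sigma> E I =
     {F \<in> I \<rightarrow>\<^sub>E omega1 E. \<exists>c.
        (\<forall>a\<in>I. F a = (\<Sum>(x, y)\<in>E. c a x y *\<^sub>C (delta x \<otimes> delta y))) \<and>
        (\<forall>x\<in>\<Sigma>. invertible_matrix I (fibre E x) (\<lambda>a y. c a x y))}"

end

(* In the coordinates on M \<otimes> V dual to \<delta>_x \<otimes> e_a, the map m \<otimes> v \<mapsto> m e(v) acts, for each x separately,
   as multiplication of a row vector by the matrix (E_{a,x,y}), so it is bijective iff all these
   matrices are invertible. An invertible matrix is square, which makes E fibred; conversely, bijections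
   from I to the fibres F_x give permutation matrices as E_{a,x,y}. Every space coacts trivially by
   v \<mapsto> v \<otimes> 1. *)

theory Submission
  imports Defs
begin

text \<open>The maps in question are \<open>undefined\<close> off their subspace, hence not linear
  on the whole type, and general facts about linear maps do not apply to them directly. The
  bijectivity criterion is therefore proved for total linear maps: \<open>e\<close> is extended
  along a projection onto \<open>V\<close>, a lift over subspaces becomes the restriction of a lift
  over \<open>UNIV\<close>, and linear maps are compared on pure tensors.

  The coordinates are themselves total lifts, pairing evaluation at x with a functional dual to
  \<open>b a\<close>. Their expansion formula and their values on
  \<open>delta x \<otimes> b a\<close> do the work of a basis theorem for tensor products.

  Rows and columns have unrelated index sets, so both inverse identities must be produced. With A =
  (E_{a,x,y}) at a fixed x and B its inverse, surjectivity yields B A = 1 and injectivity then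
  yields A B = 1; conversely A B = 1 gives injectivity and B A = 1 gives surjectivity.\<close>

section \<open>Passing from maps on subspaces to total linear maps\<close>

lemma tensor_lift_cong:
  assumes "\<And>v w. v \<in> V \<Longrightarrow> w \<in> W \<Longrightarrow> \<beta> v w = \<beta>' v w"
  shows "tensor_lift V W \<beta> = tensor_lift V W \<beta>'"
  unfolding tensor_lift_def using assms by (metis (no_types, lifting))

lemma tensor_in_tensor_space: "v \<in> V \<Longrightarrow> w \<in> W \<Longrightarrow> v \<otimes> w \<in> tensor_space V W"
  unfolding tensor_space_def by (rule cvec.span_base) blast

lemma subspace_tensor_space: "cvec.subspace (tensor_space V W)"
  unfolding tensor_space_def by (rule cvec.subspace_span)

lemma bilinear_on_subset: "bilinear_on UNIV UNIV \<beta> \<Longrightarrow> bilinear_on V W \<beta>"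
  by (simp add: bilinear_on_def)

text \<open>The restricted total lift satisfies the property that characterises the lift over
  \<open>V\<close> and \<open>W\<close>, so uniqueness identifies the two.\<close>

lemma tensor_lift_restrict:
  fixes V :: "'a::complex_vector set" and W :: "'b::complex_vector set"
  assumes "cvec.subspace V" "cvec.subspace W" "bilinear_on UNIV UNIV \<beta>"
  shows "tensor_lift V W \<beta> = restrict (tensor_lift UNIV UNIV \<beta>) (tensor_space V W)"
proof -
  note L = tensor_lift_UNIV[OF assms(3)]
  have "restrict (tensor_lift UNIV UNIV \<beta>) (tensor_space V W) \<in> lin_maps (tensor_space V W) UNIV \<and>
      (\<forall>v\<in>V. \<forall>w\<in>W. restrict (tensor_lift UNIV UNIV \<beta>) (tensor_space V W) (v \<otimes> w) = \<beta> v w)"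
    by (auto simp: lin_maps_def L(2) clinear_add[OF L(1)] clinear_scaleC[OF L(1)] tensor_in_tensor_space
        cvec.subspace_add[OF subspace_tensor_space] cvec.subspace_scale[OF subspace_tensor_space])
  then show ?thesis
    unfolding tensor_lift_def
    by (rule the1_equality[OF tensor_lift_unique[OF assms(1,2) bilinear_on_subset[OF assms(3)]]])
qed

text \<open>Composing with a linear projection onto \<open>V\<close> repairs the undefined values
  off \<open>V\<close>.\<close>

lemma lin_maps_extend:
  assumes "f \<in> lin_maps V W" "cvec.subspace V"
  obtains g where "clinear g" "\<And>v. v \<in> V \<Longrightarrow> f v = g v"
proof -
  obtain p where p: "clinear p" "\<And>a. p a \<in> V" "\<And>v. v \<in> V \<Longrightarrow> p v = v"
    using subspace_projection[OF assms(2)] by metis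
  have "clinear (\<lambda>v. f (p v))"
    using assms(1) p(2)
    by (intro clinearI) (auto simp: lin_maps_def clinear_add[OF p(1)] clinear_scaleC[OF p(1)])
  then show thesis using p(3) that by metis
qed

section \<open>Bases, dual functionals and maps prescribed on a basis\<close>

lemma is_basis_subspace: "is_basis V I b \<Longrightarrow> cvec.subspace V"
  unfolding is_basis_def by (metis cvec.subspace_span)

lemma is_basis_in: "is_basis V I b \<Longrightarrow> a \<in> I \<Longrightarrow> b a \<in> V"
  unfolding is_basis_def by (metis cvec.span_base imageI)

lemma is_basis_finite:
  assumes "is_basis V I b" "fin_dim V"
  shows "finite I"
proof -
  obtain B where "finite B" "cvec.span B = V" using assms(2) unfolding fin_dim_def by blast
  moreover have "b ` I \<subseteq> cvec.span (b ` I)" by (rule cvec.span_superset)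
  ultimately have "finite (b ` I)"
    using assms(1) cvec.independent_span_bound[of B "b ` I"] unfolding is_basis_def by auto
  then show ?thesis using assms(1) finite_imageD unfolding is_basis_def by blast
qed

lemma is_basis_card: "is_basis V I b \<Longrightarrow> card I = cvec.dim V"
  unfolding is_basis_def by (metis card_image cvec.dim_span_eq_card_independent)

text \<open>The basis is indexed by its own elements, so no separate index type has to be
  chosen.\<close>

lemma fin_dim_basis:
  assumes "fin_dim V"
  obtains B where "is_basis V B (\<lambda>v. v)"
proof -
  obtain B where "B \<subseteq> V" "cvec.independent B" "V \<subseteq> cvec.span B"
    using cvec.basis_exists[of V] by metis
  moreover have "cvec.subspace V" using assms by (simp add: fin_dim_def)
  ultimately have "cvec.span B = V" by (simp add: cvec.span_minimal set_eq_subset)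
  then have "is_basis V B (\<lambda>v. v)" using \<open>cvec.independent B\<close> by (simp add: is_basis_def)
  then show thesis by (rule that)
qed

lemma dual_basis:
  fixes V :: "'v::complex_vector set"
  assumes "is_basis V I b" "finite I"
  obtains g :: "'i \<Rightarrow> 'v \<Rightarrow> complex" where "\<And>a. clinear (g a)"
    "\<And>a a'. a \<in> I \<Longrightarrow> a' \<in> I \<Longrightarrow> g a (b a') = (if a = a' then 1 else 0)"
    "\<And>v. v \<in> V \<Longrightarrow> v = (\<Sum>a\<in>I. g a v *\<^sub>C b a)"
proof -
  note B = assms(1)[unfolded is_basis_def]
  have "\<exists>h :: 'v \<Rightarrow> complex. clinear h \<and> (\<forall>v\<in>b ` I. h v = (if v = b a then 1 else 0))" for a
    using cvec_pair.linear_independent_extend[of "b ` I" "\<lambda>v. if v = b a then 1 else 0"] B by blast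
  then obtain g :: "'i \<Rightarrow> 'v \<Rightarrow> complex" where g: "\<And>a. clinear (g a)"
      "\<And>a a'. a' \<in> I \<Longrightarrow> g a (b a') = (if b a' = b a then 1 else 0)"
    by (metis (no_types, lifting) imageI)
  have g': "g a (b a') = (if a = a' then 1 else 0)" if "a \<in> I" "a' \<in> I" for a a'
    using g(2)[OF that(2)] B that by (auto simp: inj_on_eq_iff)
  have "v = (\<Sum>a\<in>I. g a v *\<^sub>C b a)" if "v \<in> V" for v
  proof (rule cvec_pair.linear_eq_on_span[where f = "\<lambda>v. v" and B = "b ` I"])
    show "clinear (\<lambda>v :: 'v. v)" by (rule clinearI) simp_all
    show "clinear (\<lambda>v. \<Sum>a\<in>I. g a v *\<^sub>C b a)"
      by (rule clinearI)
        (simp_all add: clinear_add[OF g(1)] clinear_scaleC[OF g(1)] scaleC_add_left sum.distrib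
          cvec.scale_sum_right scaleC_complex_def)
    show "v \<in> cvec.span (b ` I)" using B that by simp
    fix u assume "u \<in> b ` I"
    then obtain a' where a': "a' \<in> I" "u = b a'" by blast
    have "(\<Sum>a\<in>I. g a u *\<^sub>C b a) = (\<Sum>a\<in>I. if a = a' then b a else 0)"
      using a' by (intro sum.cong) (auto simp: g' scaleC_one)
    then show "u = (\<Sum>a\<in>I. g a u *\<^sub>C b a)" using a' assms(2) by simp
  qed
  then show thesis using that[of g] g(1) g' by blast
qed

text \<open>A linear map is determined by its values on a basis, and these can be prescribed freely.
  Since both sides consist of functions that are \<open>undefined\<close> off their domain, this is
  a bijection of functions, not merely one up to irrelevant values.\<close>

lemma bij_betw_lin_maps_basis:
  fixes V :: "'v::complex_vector set" and W :: "'w::complex_vector set"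
  assumes "is_basis V I b" "finite I" "cvec.subspace W"
  shows "bij_betw (\<lambda>e. \<lambda>a\<in>I. e (b a)) (lin_maps V W) (I \<rightarrow>\<^sub>E W)"
  unfolding bij_betw_def
proof
  note V = is_basis_subspace[OF assms(1)]
  show "inj_on (\<lambda>e. \<lambda>a\<in>I. e (b a)) (lin_maps V W)"
  proof (rule inj_onI)
    fix e f assume e: "e \<in> lin_maps V W" and f: "f \<in> lin_maps V W"
      and eq: "(\<lambda>a\<in>I. e (b a)) = (\<lambda>a\<in>I. f (b a))"
    obtain e' where e': "clinear e'" "\<And>v. v \<in> V \<Longrightarrow> e v = e' v"
      using lin_maps_extend[OF e V] by metis
    obtain f' where f': "clinear f'" "\<And>v. v \<in> V \<Longrightarrow> f v = f' v"
      using lin_maps_extend[OF f V] by metis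
    have "e (b a) = f (b a)" if "a \<in> I" for a using fun_cong[OF eq, of a] that by simp
    then have *: "e' u = f' u" if "u \<in> b ` I" for u
      using that e'(2) f'(2) is_basis_in[OF assms(1)] by fastforce
    have "e' v = f' v" if "v \<in> V" for v
      by (rule cvec_pair.linear_eq_on_span[OF e'(1) f'(1), of "b ` I"])
        (use * that assms(1) in \<open>auto simp: is_basis_def\<close>)
    then show "e = f"
      using e f e'(2) f'(2) by (intro PiE_ext[of e V "\<lambda>_. W" f]) (auto simp: lin_maps_def)
  qed
  show "(\<lambda>e. \<lambda>a\<in>I. e (b a)) ` lin_maps V W = (I \<rightarrow>\<^sub>E W)"
  proof (intro equalityI subsetI)
    fix F assume "F \<in> (\<lambda>e. \<lambda>a\<in>I. e (b a)) ` lin_maps V W"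
    then show "F \<in> I \<rightarrow>\<^sub>E W" using is_basis_in[OF assms(1)] by (auto simp: lin_maps_def)
  next
    fix F assume F: "F \<in> I \<rightarrow>\<^sub>E W"
    obtain g :: "'a \<Rightarrow> 'v \<Rightarrow> complex" where g: "\<And>a. clinear (g a)"
      "\<And>a a'. a \<in> I \<Longrightarrow> a' \<in> I \<Longrightarrow> g a (b a') = (if a = a' then 1 else 0)"
      using dual_basis[OF assms(1,2)] by metis
    define e where "e = restrict (\<lambda>v. \<Sum>a\<in>I. g a v *\<^sub>C F a) V"
    have "e \<in> lin_maps V W"
      using F cvec.subspace_add[OF V] cvec.subspace_scale[OF V]
      by (auto simp: lin_maps_def e_def clinear_add[OF g(1)] clinear_scaleC[OF g(1)] scaleC_add_left
          sum.distrib cvec.scale_sum_right scaleC_complex_def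
          intro!: cvec.subspace_sum[OF assms(3)] cvec.subspace_scale[OF assms(3)])
    moreover have "e (b a') = F a'" if "a' \<in> I" for a'
    proof -
      have "e (b a') = (\<Sum>a\<in>I. g a (b a') *\<^sub>C F a)"
        using is_basis_in[OF assms(1)] that by (simp add: e_def)
      also have "\<dots> = (\<Sum>a\<in>I. if a = a' then F a else 0)"
        using that by (intro sum.cong) (auto simp: g(2) scaleC_one)
      finally show ?thesis using that assms(2) by simp
    qed
    then have "F = (\<lambda>a\<in>I. e (b a))" using F by (auto simp: fun_eq_iff PiE_def extensional_def)
    ultimately show "F \<in> (\<lambda>e. \<lambda>a\<in>I. e (b a)) ` lin_maps V W" by blast
  qed
qed

section \<open>Invertible matrices between different index sets\<close>

lemma invertible_matrix_cong:
  assumes "\<And>i j. i \<in> I \<Longrightarrow> j \<in> J \<Longrightarrow> A i j = A' i j"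
  shows "invertible_matrix I J A \<longleftrightarrow> invertible_matrix I J A'"
  unfolding invertible_matrix_def using assms by (simp cong: sum.cong)

text \<open>The trace of \<open>A B\<close> equals the trace of \<open>B A\<close>.\<close>

lemma invertible_matrix_card:
  assumes "invertible_matrix I J A"
  shows "card I = card J"
proof -
  obtain B where B: "\<forall>i\<in>I. \<forall>i'\<in>I. (\<Sum>j\<in>J. A i j * B j i') = (if i = i' then 1 else 0)"
     "\<forall>j\<in>J. \<forall>j'\<in>J. (\<Sum>i\<in>I. B j i * A i j') = (if j = j' then 1 else 0)"
    using assms unfolding invertible_matrix_def by blast
  have "of_nat (card I) = (\<Sum>i\<in>I. \<Sum>j\<in>J. A i j * B j i)" using B(1) by simp
  also have "\<dots> = (\<Sum>j\<in>J. \<Sum>i\<in>I. B j i * A i j)"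
    by (subst sum.swap) (simp add: mult.commute)
  also have "\<dots> = of_nat (card J)" using B(2) by simp
  \<comment> \<open>Characteristic zero: the two traces, as complex numbers, remember the
    cardinalities.\<close>
  finally show ?thesis by (simp only: of_nat_eq_iff)
qed

text \<open>The inverse is the transpose.\<close>

lemma invertible_matrix_permutation:
  assumes "bij_betw \<sigma> I J" "finite I"
  shows "invertible_matrix I J (\<lambda>i j. if \<sigma> i = j then 1 else 0)"
proof -
  have inj: "inj_on \<sigma> I" and J: "J = \<sigma> ` I" using assms(1) by (auto simp: bij_betw_def)
  then have "finite J" using assms(2) by simp
  have *: "(if \<sigma> i = j then 1 else 0) * (if \<sigma> i' = j then 1 else 0)
      = (if j = \<sigma> i then if i = i' then 1 else 0 else (0 :: complex))"
    if "i \<in> I" "i' \<in> I" for i i' j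
    using that inj by (auto simp: inj_on_eq_iff)
  have "(\<Sum>j\<in>J. (if \<sigma> i = j then 1 else 0) * (if \<sigma> i' = j then 1 else 0))
      = (if i = i' then 1 else (0 :: complex))" if "i \<in> I" "i' \<in> I" for i i'
    using that \<open>finite J\<close> J by (subst sum.cong[OF refl *[OF that]]) simp
  moreover have "(\<Sum>i\<in>I. (if \<sigma> i = j then 1 else 0) * (if \<sigma> i = j' then 1 else 0))
      = (if j = j' then 1 else (0 :: complex))" if "j \<in> J" "j' \<in> J" for j j'
  proof -
    from that(1) J obtain k where k: "k \<in> I" "\<sigma> k = j" by blast
    have "(\<Sum>i\<in>I. (if \<sigma> i = j then 1 else 0) * (if \<sigma> i = j' then 1 else 0))
        = (\<Sum>i\<in>I. if i = k then if j = j' then 1 else 0 else (0 :: complex))"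
      by (rule sum.cong) (use k inj in \<open>auto simp: inj_on_eq_iff\<close>)
    then show ?thesis using k assms(2) by simp
  qed
  ultimately show ?thesis
    unfolding invertible_matrix_def
    by (intro exI[of _ "\<lambda>j i. if \<sigma> i = j then 1 else 0"]) blast
qed

section \<open>Left multiplication and coefficients of 1-forms\<close>

text \<open>\<open>lact m\<close> is lifted separately for each \<open>m\<close>, so linearity in
  \<open>m\<close> does not come with the lift and is checked on pure tensors. It is what makes
  \<open>lact m (e v)\<close> bilinear in \<open>m\<close> and \<open>v\<close>.\<close>

lemma
  fixes m m' :: "'s \<Rightarrow> complex" and t :: "('s \<Rightarrow> complex, 'b::complex_vector) tensor"
  shows clinear_lact: "clinear (lact m :: (_, 'b) tensor \<Rightarrow> _)"
    and lact_tensor_prod: "lact m (f \<otimes> w) = (m * f) \<otimes> (w :: 'b)"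
    and lact_add_left: "lact (m + m') t = lact m t + lact m' t"
    and lact_scaleC_left: "lact (c *\<^sub>C m) t = c *\<^sub>C lact m t"
proof -
  have "bilinear_on UNIV UNIV (\<lambda>f (w :: 'b). (m * f) \<otimes> id w)" for m :: "'s \<Rightarrow> complex"
    by (simp add: bilinear_on_def tensor_prod_add_left tensor_prod_add_right tensor_prod_scaleC_left
        tensor_prod_scaleC_right mult_scaleC_right distrib_left)
  from tensor_lift_UNIV[OF this]
  have L: "clinear (lact m :: (_, 'b) tensor \<Rightarrow> _)" "lact m (f \<otimes> w) = (m * f) \<otimes> (w :: 'b)"
    for m f :: "'s \<Rightarrow> complex" and w
    unfolding lact_def tensor_map_def by simp_all
  show "clinear (lact m :: (_, 'b) tensor \<Rightarrow> _)" "lact m (f \<otimes> w) = (m * f) \<otimes> w" by (rule L)+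
  show "lact (m + m') t = lact m t + lact m' t"
  proof (rule clinear_eq_on_tensor[OF L(1)])
    show "clinear (\<lambda>t :: (_, 'b) tensor. lact m t + lact m' t)"
      by (rule clinearI) (simp_all add: clinear_add[OF L(1)] clinear_scaleC[OF L(1)] scaleC_add_right)
    show "lact (m + m') (f \<otimes> w) = lact m (f \<otimes> w) + lact m' (f \<otimes> w)" for f and w :: 'b
      by (simp only: L(2) distrib_right tensor_prod_add_left)
  qed
  show "lact (c *\<^sub>C m) t = c *\<^sub>C lact m t"
    by (rule clinear_eq_on_tensor[OF L(1)])
      (auto intro!: clinearI simp: clinear_add[OF L(1)] clinear_scaleC[OF L(1)] L(2)
        mult_scaleC_left tensor_prod_scaleC_left scaleC_add_right cvec.scale_left_commute)
qed

text \<open>This decouples the bein condition over \<Sigma>: left multiplication scales the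
  coefficients in row x by the single number \<open>m x\<close> and mixes no rows.\<close>

lemma coef_lact: "coef (lact m t) x y = m x * coef t x y"
  by (rule clinear_eq_on_tensor[where f = "\<lambda>t. coef (lact m t) x y"])
    (auto intro!: clinearI simp: clinear_add[OF clinear_lact] clinear_scaleC[OF clinear_lact]
      clinear_add[OF clinear_coef] clinear_scaleC[OF clinear_coef] lact_tensor_prod
      scaleC_complex_def algebra_simps)

lemma subspace_omega1: "cvec.subspace (omega1 E)"
  unfolding omega1_def by (rule cvec.subspace_span)

lemma delta_omega1: "(x, y) \<in> E \<Longrightarrow> delta x \<otimes> delta y \<in> omega1 E"
  unfolding omega1_def by (rule cvec.span_base) blast

text \<open>\<open>calculus_proj E\<close> fixes the generators of \<open>omega1 E\<close>, hence
  all of it, and its formula in terms of \<open>coef\<close> is the expansion.\<close>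

lemma omega1_expand:
  assumes "finite E" "w \<in> omega1 E"
  shows "w = (\<Sum>(x, y)\<in>E. coef w x y *\<^sub>C (delta x \<otimes> delta y))"
proof -
  have "calculus_proj E w = w"
  proof (rule cvec_pair.linear_eq_on_span[OF clinear_calculus_proj])
    show "clinear (\<lambda>t :: ('a \<Rightarrow> complex, 'a \<Rightarrow> complex) tensor. t)" by (rule clinearI) simp_all
    show "w \<in> cvec.span {delta x \<otimes> delta y | x y. (x, y) \<in> E}" using assms(2) unfolding omega1_def .
  qed (auto simp: calculus_proj_delta[OF assms(1)])
  then show ?thesis unfolding calculus_proj_coef by simp
qed

lemma omega1_eqI:
  assumes "finite E" "w \<in> omega1 E" "w' \<in> omega1 E" "\<And>x y. (x, y) \<in> E \<Longrightarrow> coef w x y = coef w' x y"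
  shows "w = w'"
  by (subst omega1_expand[OF assms(1,2)], subst omega1_expand[OF assms(1,3)], rule sum.cong)
    (auto simp: assms(4))

text \<open>\<open>w\<close> is its own projection and the projection commutes with
  \<open>lact m\<close>, so \<open>lact m w\<close> lies in the range of the projection.\<close>

lemma lact_omega1:
  assumes "finite \<Sigma>" "E \<subseteq> \<Sigma> \<times> \<Sigma> - Id" "w \<in> omega1 E"
  shows "lact m w \<in> omega1 E"
proof -
  have "finite E" using assms by (meson finite_Diff finite_SigmaI finite_subset)
  then have "w = calculus_proj E w"
    using omega1_expand[OF _ assms(3)] by (simp add: calculus_proj_coef)
  then have "lact m w = calculus_proj E (lact m w)" by (simp add: calculus_quotient(4)[OF assms(1,2)])
  then show ?thesis by (metis calculus_proj_omega1)
qed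

lemma coef_sum_delta:
  assumes "finite E" "(x, y) \<in> E"
  shows "coef (\<Sum>(x, y)\<in>E. c x y *\<^sub>C (delta x \<otimes> delta y)) x y = c x y"
proof -
  have "coef (\<Sum>(x, y)\<in>E. c x y *\<^sub>C (delta x \<otimes> delta y)) x y
      = (\<Sum>p\<in>E. if p = (x, y) then c x y else 0)"
    unfolding cvec_pair.linear_sum[OF clinear_coef]
    by (rule sum.cong)
      (auto simp: clinear_scaleC[OF clinear_coef] coef_delta scaleC_complex_def simp del: coef_tensor_prod split: if_splits)
  then show ?thesis using assms by simp
qed

text \<open>The family \<open>c\<close> in the definition is forced on E, and the matrix at x only
  involves entries with (x, y) in E. So the existential can be replaced by the actual
  coefficients.\<close>

lemma bein_forms_iff:
  assumes "finite E"
  shows "F \<in> bein_forms \<Sigma> E I \<longleftrightarrow>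
    F \<in> I \<rightarrow>\<^sub>E omega1 E \<and> (\<forall>x\<in>\<Sigma>. invertible_matrix I (fibre E x) (\<lambda>a y. coef (F a) x y))"
proof
  assume "F \<in> bein_forms \<Sigma> E I"
  then obtain c where F: "F \<in> I \<rightarrow>\<^sub>E omega1 E"
      "\<forall>a\<in>I. F a = (\<Sum>(x, y)\<in>E. c a x y *\<^sub>C (delta x \<otimes> delta y))"
    and inv: "\<forall>x\<in>\<Sigma>. invertible_matrix I (fibre E x) (\<lambda>a y. c a x y)"
    unfolding bein_forms_def by blast
  have "invertible_matrix I (fibre E x) (\<lambda>a y. coef (F a) x y)
      \<longleftrightarrow> invertible_matrix I (fibre E x) (\<lambda>a y. c a x y)" for x
    by (rule invertible_matrix_cong) (use F in \<open>auto simp: fibre_def coef_sum_delta[OF assms]\<close>)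
  then show "F \<in> I \<rightarrow>\<^sub>E omega1 E \<and> (\<forall>x\<in>\<Sigma>. invertible_matrix I (fibre E x) (\<lambda>a y. coef (F a) x y))"
    using F inv by blast
next
  assume "F \<in> I \<rightarrow>\<^sub>E omega1 E \<and> (\<forall>x\<in>\<Sigma>. invertible_matrix I (fibre E x) (\<lambda>a y. coef (F a) x y))"
  then have "F \<in> I \<rightarrow>\<^sub>E omega1 E"
      and "\<forall>x\<in>\<Sigma>. invertible_matrix I (fibre E x) (\<lambda>a y. coef (F a) x y)"
    by blast+
  moreover from this have "\<forall>a\<in>I. F a = (\<Sum>(x, y)\<in>E. coef (F a) x y *\<^sub>C (delta x \<otimes> delta y))"
    using omega1_expand[OF assms] by blast
  ultimately show "F \<in> bein_forms \<Sigma> E I"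
    unfolding bein_forms_def by (intro CollectI conjI exI[of _ "\<lambda>a x y. coef (F a) x y"])
qed

section \<open>The delta-functions as a basis\<close>

lemma functions_on_expand:
  assumes "finite \<Sigma>" "f \<in> functions_on \<Sigma>"
  shows "f = (\<Sum>x\<in>\<Sigma>. f x *\<^sub>C delta x)"
proof
  fix z
  have "(\<Sum>x\<in>\<Sigma>. f x *\<^sub>C delta x) z = (\<Sum>x\<in>\<Sigma>. f x * delta x z)"
    by (induction \<Sigma> rule: infinite_finite_induct) (simp_all add: scaleC_fun_def scaleC_complex_def)
  also have "\<dots> = f z"
    using assms by (auto simp: delta_def functions_on_def if_distrib[of "times _"] cong: if_cong)
  finally show "f z = (\<Sum>x\<in>\<Sigma>. f x *\<^sub>C delta x) z" ..
qed

lemma delta_functions_on: "x \<in> \<Sigma> \<Longrightarrow> delta x \<in> functions_on \<Sigma>"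
  by (auto simp: delta_def functions_on_def)

text \<open>Evaluation at z isolates the coefficient of \<open>delta z\<close>. Applied to
  \<open>{..<n}\<close> later on, this supplies a space of dimension n.\<close>

lemma is_basis_delta:
  assumes "finite \<Sigma>"
  shows "is_basis (functions_on \<Sigma>) \<Sigma> delta"
proof -
  have inj: "inj (delta :: 'a \<Rightarrow> _)"
    by (rule injI) (metis delta_def zero_neq_one)
  have "cvec.independent (delta ` \<Sigma>)"
  proof (rule cvec.independent_if_scalars_zero)
    fix u :: "('a \<Rightarrow> complex) \<Rightarrow> complex" and f
    assume 0: "(\<Sum>f\<in>delta ` \<Sigma>. u f *\<^sub>C f) = 0" and "f \<in> delta ` \<Sigma>"
    then obtain z where z: "z \<in> \<Sigma>" "f = delta z" by blast
    have lin: "clinear (\<lambda>f :: 'a \<Rightarrow> complex. f z)" by (rule clinearI) (simp_all add: scaleC_fun_def)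
    have "0 = (\<Sum>f\<in>delta ` \<Sigma>. u f *\<^sub>C f) z" using 0 by simp
    also have "\<dots> = (\<Sum>x\<in>\<Sigma>. u (delta x) * delta x z)"
      unfolding cvec_pair.linear_sum[OF lin]
      by (subst sum.reindex) (use inj in \<open>auto simp: inj_on_def inj_def scaleC_fun_def scaleC_complex_def\<close>)
    also have "\<dots> = u f" using z assms by (auto simp: delta_def if_distrib[of "times _"] cong: if_cong)
    finally show "u f = 0" ..
  qed (use assms in simp)
  moreover have "cvec.span (delta ` \<Sigma>) = functions_on \<Sigma>"
  proof
    show "cvec.span (delta ` \<Sigma>) \<subseteq> functions_on \<Sigma>"
      by (rule cvec.span_minimal[OF _ subspace_functions_on]) (auto intro: delta_functions_on)
    show "functions_on \<Sigma> \<subseteq> cvec.span (delta ` \<Sigma>)"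
    proof
      fix f assume "f \<in> functions_on \<Sigma>"
      then show "f \<in> cvec.span (delta ` \<Sigma>)"
        by (subst functions_on_expand[OF assms])
          (auto intro!: cvec.span_sum cvec.span_scale intro: cvec.span_base)
    qed
  qed
  ultimately show ?thesis using inj by (auto simp: is_basis_def inj_on_def inj_def)
qed

section \<open>Bijectivity as invertibility at every point\<close>

lemma clinear_sum_scaleC:
  fixes h :: "'k \<Rightarrow> 'a::complex_vector \<Rightarrow> complex"
  assumes "\<And>k. clinear (h k)"
  shows "clinear (\<lambda>t. \<Sum>k\<in>K. h k t *\<^sub>C z k)"
  by (rule clinearI) (simp_all add: clinear_add[OF assms] clinear_scaleC[OF assms] scaleC_add_left
      sum.distrib cvec.scale_sum_right scaleC_complex_def)

lemma bij_betw_lact_iff_invertible: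
  fixes \<Sigma> :: "'s set" and V :: "'v::complex_vector set"
    and e :: "'v \<Rightarrow> ('s \<Rightarrow> complex, 's \<Rightarrow> complex) tensor"
  assumes fin: "finite \<Sigma>" and E: "E \<subseteq> \<Sigma> \<times> \<Sigma> - Id" and I: "finite I" and basis: "is_basis V I b"
    and lin_e: "clinear e" and e: "\<And>v. v \<in> V \<Longrightarrow> e v \<in> omega1 E"
  shows "bij_betw (tensor_lift (functions_on \<Sigma>) V (\<lambda>m v. lact m (e v)))
           (tensor_space (functions_on \<Sigma>) V) (omega1 E) \<longleftrightarrow>
         (\<forall>x\<in>\<Sigma>. invertible_matrix I (fibre E x) (\<lambda>a y. coef (e (b a)) x y))"
proof -
  let ?M = "functions_on \<Sigma>"
  let ?S = "tensor_space ?M V"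
  note V = is_basis_subspace[OF basis]
  have finE: "finite E" using fin E by (meson finite_Diff finite_SigmaI finite_subset)
  have EI: "x \<in> \<Sigma>" if "(x, y) \<in> E" for x y using that E by auto
  define A where "A x a y = coef (e (b a)) x y" for x a y
  \<comment> \<open>\<open>T\<close> is the total counterpart of the map in the claim;
    \<open>restr\<close> below says that the latter is \<open>T\<close> restricted to
    \<open>?S\<close>.\<close>
  define T where "T = tensor_lift UNIV UNIV (\<lambda>m v. lact m (e v))"
  have "bilinear_on UNIV UNIV (\<lambda>m v. lact m (e v))"
    by (simp add: bilinear_on_def clinear_add[OF lin_e] clinear_scaleC[OF lin_e] clinear_add[OF clinear_lact]
        clinear_scaleC[OF clinear_lact] lact_add_left lact_scaleC_left)
  note T = tensor_lift_UNIV[OF this, folded T_def]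
    and restr = tensor_lift_restrict[OF subspace_functions_on V this, folded T_def]
  obtain g :: "'a \<Rightarrow> 'v \<Rightarrow> complex" where lin_g: "\<And>a. clinear (g a)"
    and g_b: "\<And>a a'. a \<in> I \<Longrightarrow> a' \<in> I \<Longrightarrow> g a (b a') = (if a = a' then 1 else 0)"
    and g_expand: "\<And>v. v \<in> V \<Longrightarrow> v = (\<Sum>a\<in>I. g a v *\<^sub>C b a)"
    using dual_basis[OF basis I] by metis
  \<comment> \<open>The coordinate belonging to \<open>delta x \<otimes> b a\<close>: evaluation at
    x tensored with the dual functional \<open>g a\<close>.\<close>
  define \<phi> where "\<phi> x a = tensor_lift UNIV UNIV (\<lambda>f v. f x * g a v)" for x :: 's and a
  have "bilinear_on UNIV UNIV (\<lambda>f v. f x * g a v)" for x :: 's and a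
    by (simp add: bilinear_on_def clinear_add[OF lin_g] clinear_scaleC[OF lin_g] scaleC_fun_def
        scaleC_complex_def algebra_simps)
  note \<phi> = tensor_lift_UNIV[OF this, folded \<phi>_def]
  have coef_T: "coef (T t) x y = (\<Sum>a\<in>I. \<phi> x a t * A x a y)" if "t \<in> ?S" for t x y
  proof -
    have "coef (T t) x y = (\<Sum>a\<in>I. \<phi> x a t *\<^sub>C A x a y)"
    proof (rule clinear_eq_on_tensor_space[where f = "\<lambda>t. coef (T t) x y"
          and g = "\<lambda>t. \<Sum>a\<in>I. \<phi> x a t *\<^sub>C A x a y", OF _ _ _ that])
      show "clinear (\<lambda>t. \<Sum>a\<in>I. \<phi> x a t *\<^sub>C A x a y)" by (rule clinear_sum_scaleC[OF \<phi>(1)])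
      show "clinear (\<lambda>t. coef (T t) x y)"
        by (rule clinearI) (simp_all add: clinear_add[OF T(1)] clinear_scaleC[OF T(1)]
            clinear_add[OF clinear_coef] clinear_scaleC[OF clinear_coef])
      fix f :: "'s \<Rightarrow> complex" and v assume "v \<in> V"
      have "coef (e v) x y = (\<Sum>a\<in>I. g a v * A x a y)"
        by (subst g_expand[OF \<open>v \<in> V\<close>])
          (simp add: cvec_pair.linear_sum[OF lin_e] clinear_scaleC[OF lin_e] cvec_pair.linear_sum[OF clinear_coef]
            clinear_scaleC[OF clinear_coef] A_def scaleC_complex_def)
      then show "coef (T (f \<otimes> v)) x y = (\<Sum>a\<in>I. \<phi> x a (f \<otimes> v) *\<^sub>C A x a y)"
        by (simp add: T(2) \<phi>(2) coef_lact scaleC_complex_def sum_distrib_left mult.assoc)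
    qed
    then show ?thesis by (simp add: scaleC_complex_def)
  qed
  have expand: "t = (\<Sum>(x, a)\<in>\<Sigma> \<times> I. \<phi> x a t *\<^sub>C (delta x \<otimes> b a))" if "t \<in> ?S" for t
  proof -
    have "t = (\<Sum>p\<in>\<Sigma> \<times> I. \<phi> (fst p) (snd p) t *\<^sub>C (delta (fst p) \<otimes> b (snd p)))"
    proof (rule clinear_eq_on_tensor_space[where f = "\<lambda>t. t"
          and g = "\<lambda>t. \<Sum>p\<in>\<Sigma> \<times> I. \<phi> (fst p) (snd p) t *\<^sub>C (delta (fst p) \<otimes> b (snd p))", OF _ _ _ that])
      show "clinear (\<lambda>t :: ('s \<Rightarrow> complex, 'v) tensor. t)" by (rule clinearI) simp_all
      show "clinear (\<lambda>t. \<Sum>p\<in>\<Sigma> \<times> I. \<phi> (fst p) (snd p) t *\<^sub>C (delta (fst p) \<otimes> b (snd p)))"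
        by (rule clinear_sum_scaleC[OF \<phi>(1)])
      fix f :: "'s \<Rightarrow> complex" and v assume f: "f \<in> ?M" and v: "v \<in> V"
      have l: "clinear (\<lambda>f :: 's \<Rightarrow> complex. f \<otimes> v)" for v :: 'v
        by (rule clinearI) (simp_all add: tensor_prod_add_left tensor_prod_scaleC_left)
      have r: "clinear (\<lambda>v :: 'v. f \<otimes> v)" for f :: "'s \<Rightarrow> complex"
        by (rule clinearI) (simp_all add: tensor_prod_add_right tensor_prod_scaleC_right)
      have "f \<otimes> v = (\<Sum>x\<in>\<Sigma>. f x *\<^sub>C delta x) \<otimes> (\<Sum>a\<in>I. g a v *\<^sub>C b a)"
        using functions_on_expand[OF fin f] g_expand[OF v] by metis
      also have "\<dots> = (\<Sum>x\<in>\<Sigma>. \<Sum>a\<in>I. (f x * g a v) *\<^sub>C (delta x \<otimes> b a))"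
        by (simp add: cvec_pair.linear_sum[OF l] cvec_pair.linear_sum[OF r]
            tensor_prod_scaleC_left tensor_prod_scaleC_right cvec.scale_sum_right mult.commute)
          (rule sum.swap)
      also have "\<dots> = (\<Sum>p\<in>\<Sigma> \<times> I. \<phi> (fst p) (snd p) (f \<otimes> v) *\<^sub>C (delta (fst p) \<otimes> b (snd p)))"
        by (simp add: \<phi>(2) sum.cartesian_product case_prod_unfold)
      finally show "f \<otimes> v = \<dots>" .
    qed
    then show ?thesis by (simp add: case_prod_unfold)
  qed
  have T_omega1: "T t \<in> omega1 E" if "t \<in> ?S" for t
    using that unfolding tensor_space_def
  proof (induction rule: cvec.span_induct_alt)
    case base
    show ?case using cvec.subspace_0[OF subspace_omega1] by (simp add: cvec_pair.linear_0[OF T(1)])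
  next
    case (step c s t)
    then obtain f v where "s = f \<otimes> v" "v \<in> V" by blast
    then have "T s \<in> omega1 E" by (simp add: T(2) lact_omega1[OF fin E] e)
    then show ?case
      using step by (simp add: clinear_add[OF T(1)] clinear_scaleC[OF T(1)]
          cvec.subspace_add[OF subspace_omega1] cvec.subspace_scale[OF subspace_omega1])
  qed
  have delta_b: "delta x \<otimes> b a \<in> ?S" if "x \<in> \<Sigma>" "a \<in> I" for x a
    using that by (simp add: tensor_in_tensor_space delta_functions_on is_basis_in[OF basis])
  have \<phi>_delta: "\<phi> x a (delta x' \<otimes> b a') = (if x = x' \<and> a = a' then 1 else 0)" if "a \<in> I" "a' \<in> I"
    for x x' a a'
    using that by (simp add: \<phi>(2) g_b delta_def)
  have "bij_betw T ?S (omega1 E) \<longleftrightarrow> (\<forall>x\<in>\<Sigma>. invertible_matrix I (fibre E x) (A x))"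
  proof
    assume bij: "bij_betw T ?S (omega1 E)"
    show "\<forall>x\<in>\<Sigma>. invertible_matrix I (fibre E x) (A x)"
    proof
      fix x assume x: "x \<in> \<Sigma>"
      have fib: "finite (fibre E x)"
        using finE by (rule finite_surj[where f = snd]) (force simp: fibre_def)
      \<comment> \<open>Surjectivity provides the inverse matrix: its row y consists of the
        coordinates at x of a preimage \<open>s y\<close> of
        \<open>delta x \<otimes> delta y\<close>. Reading off row x of \<open>T (s y)\<close> is the
        identity B A = 1.\<close>
      have "\<forall>y\<in>fibre E x. \<exists>t\<in>?S. T t = delta x \<otimes> delta y"
      proof
        fix y assume "y \<in> fibre E x"
        then have "delta x \<otimes> delta y \<in> T ` ?S"
          using bij delta_omega1 by (auto simp: bij_betw_def fibre_def)
        then show "\<exists>t\<in>?S. T t = delta x \<otimes> delta y" by (metis imageE)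
      qed
      then obtain s where s: "\<And>y. y \<in> fibre E x \<Longrightarrow> s y \<in> ?S \<and> T (s y) = delta x \<otimes> delta y"
        by metis
      have "(\<Sum>a\<in>I. \<phi> x a (s y) * A x a y') = (if y = y' then 1 else 0)"
        if "y \<in> fibre E x" for y y'
        using s[OF that] coef_T[of "s y" x y'] by (auto simp: delta_def)
      moreover have "(\<Sum>y\<in>fibre E x. A x a y * \<phi> x a' (s y)) = (if a = a' then 1 else 0)"
        if a: "a \<in> I" "a' \<in> I" for a a'
      proof -
        \<comment> \<open>For A B = 1: \<open>T t\<close> is row x of the 1-form
          \<open>e (b a)\<close>, and so is \<open>T (delta x \<otimes> b a)\<close>. Injectivity
          gives \<open>t = delta x \<otimes> b a\<close>, and applying \<open>\<phi> x a'\<close> to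
          both sides yields the matrix entry.\<close>
        define t where "t = (\<Sum>y\<in>fibre E x. A x a y *\<^sub>C s y)"
        have t: "t \<in> ?S"
          unfolding t_def using s
          by (auto intro!: cvec.subspace_sum cvec.subspace_scale subspace_tensor_space)
        have "T t = (\<Sum>y\<in>fibre E x. A x a y *\<^sub>C (delta x \<otimes> delta y))"
          using s by (simp add: t_def cvec_pair.linear_sum[OF T(1)] clinear_scaleC[OF T(1)])
        then have "coef (T t) x' y' = (\<Sum>y\<in>fibre E x. if y = y' then (if x' = x then A x a y' else 0) else 0)"
          for x' y'
          by (auto simp: cvec_pair.linear_sum[OF clinear_coef] clinear_scaleC[OF clinear_coef]
              delta_def scaleC_complex_def intro!: sum.cong sum.neutral)
        then have "coef (T t) x' y' = coef (T (delta x \<otimes> b a)) x' y'" if "(x', y') \<in> E" for x' y'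
          using that fib by (auto simp: T(2) coef_lact A_def delta_def fibre_def)
        then have "T t = T (delta x \<otimes> b a)"
          by (intro omega1_eqI[OF finE] T_omega1 t delta_b x a(1))
        then have "t = delta x \<otimes> b a"
          using bij t delta_b[OF x a(1)] by (meson bij_betw_imp_inj_on inj_onD)
        then have "\<phi> x a' t = (if a = a' then 1 else 0)" using a by (auto simp: \<phi>_delta)
        then show ?thesis
          by (simp add: t_def cvec_pair.linear_sum[OF \<phi>(1)] clinear_scaleC[OF \<phi>(1)] scaleC_complex_def)
      qed
      ultimately show "invertible_matrix I (fibre E x) (A x)"
        unfolding invertible_matrix_def by (intro exI[of _ "\<lambda>y a. \<phi> x a (s y)"]) blast
    qed
  next
    assume "\<forall>x\<in>\<Sigma>. invertible_matrix I (fibre E x) (A x)"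
    from bchoice[OF this[unfolded invertible_matrix_def]]
    obtain B where B: "\<forall>x\<in>\<Sigma>.
        (\<forall>i\<in>I. \<forall>i'\<in>I. (\<Sum>j\<in>fibre E x. A x i j * B x j i') = (if i = i' then 1 else 0)) \<and>
        (\<forall>j\<in>fibre E x. \<forall>j'\<in>fibre E x. (\<Sum>i\<in>I. B x j i * A x i j') = (if j = j' then 1 else 0))" ..
    have AB: "(\<Sum>j\<in>fibre E x. A x i j * B x j i') = (if i = i' then 1 else 0)"
      if "x \<in> \<Sigma>" "i \<in> I" "i' \<in> I" for x i i'
      using bspec[OF B that(1)] that by blast
    have BA: "(\<Sum>i\<in>I. B x j i * A x i j') = (if j = j' then 1 else 0)"
      if "x \<in> \<Sigma>" "j \<in> fibre E x" "j' \<in> fibre E x" for x j j'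
      using bspec[OF B that(1)] that by blast
    \<comment> \<open>Multiplying the vanishing row of coefficients by B from the right recovers the
      coordinates of \<open>t\<close>, by A B = 1.\<close>
    have kernel: "t = 0" if t: "t \<in> ?S" "T t = 0" for t
    proof -
      have "\<phi> x a t = 0" if "x \<in> \<Sigma>" "a \<in> I" for x a
      proof -
        have "0 = (\<Sum>y\<in>fibre E x. coef (T t) x y * B x y a)"
          by (simp add: t(2) cvec_pair.linear_0[OF clinear_coef])
        also have "\<dots> = (\<Sum>a'\<in>I. \<phi> x a' t * (\<Sum>y\<in>fibre E x. A x a' y * B x y a))"
          by (simp add: coef_T[OF t(1)] sum_distrib_left sum_distrib_right mult.assoc) (rule sum.swap)
        also have "\<dots> = \<phi> x a t"
          using that I by (simp add: AB if_distrib[of "times _"] cong: if_cong)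
        finally show ?thesis ..
      qed
      then show ?thesis by (subst expand[OF t(1)]) (auto intro!: sum.neutral)
    qed
    have "inj_on T ?S"
    proof (rule inj_onI)
      fix t u assume "t \<in> ?S" "u \<in> ?S" "T t = T u"
      then have "t - u = 0"
        by (intro kernel)
          (simp_all add: cvec.subspace_diff[OF subspace_tensor_space] cvec_pair.linear_diff[OF T(1)])
      then show "t = u" by simp
    qed
    moreover have "w \<in> T ` ?S" if w: "w \<in> omega1 E" for w
    proof -
      \<comment> \<open>The preimage is found by solving row by row: its coordinates at x are row x
        of \<open>w\<close> times B, and B A = 1 returns \<open>w\<close>.\<close>
      define t where "t = (\<Sum>(x, a)\<in>\<Sigma> \<times> I. (\<Sum>y\<in>fibre E x. coef w x y * B x y a) *\<^sub>C (delta x \<otimes> b a))"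
      have t: "t \<in> ?S"
        unfolding t_def
        by (auto intro!: cvec.subspace_sum cvec.subspace_scale subspace_tensor_space delta_b)
      have \<phi>_t: "\<phi> x a t = (\<Sum>y\<in>fibre E x. coef w x y * B x y a)" if "x \<in> \<Sigma>" "a \<in> I" for x a
      proof -
        have "\<phi> x a t = (\<Sum>p\<in>\<Sigma> \<times> I. if p = (x, a) then (\<Sum>y\<in>fibre E x. coef w x y * B x y a) else 0)"
          unfolding t_def cvec_pair.linear_sum[OF \<phi>(1)]
          by (rule sum.cong)
            (use that in \<open>auto simp: clinear_scaleC[OF \<phi>(1)] \<phi>_delta scaleC_complex_def split: if_splits\<close>)
        then show ?thesis using that fin I by simp
      qed
      have "T t = w"
      proof (rule omega1_eqI[OF finE T_omega1[OF t] w])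
        fix x y assume xy: "(x, y) \<in> E"
        then have fib: "finite (fibre E x)" "y \<in> fibre E x"
          using finite_surj[OF finE, of "fibre E x" snd] by (force simp: fibre_def)+
        have "coef (T t) x y = (\<Sum>a\<in>I. (\<Sum>y'\<in>fibre E x. coef w x y' * B x y' a) * A x a y)"
          using \<phi>_t[OF EI[OF xy]] by (simp add: coef_T[OF t])
        also have "\<dots> = (\<Sum>y'\<in>fibre E x. coef w x y' * (\<Sum>a\<in>I. B x y' a * A x a y))"
          by (simp add: sum_distrib_left sum_distrib_right mult.assoc) (rule sum.swap)
        also have "\<dots> = coef w x y"
          using fib by (simp add: BA[OF EI[OF xy]] if_distrib[of "times _"] cong: if_cong)
        finally show "coef (T t) x y = coef w x y" .
      qed
      then show ?thesis using t by blast
    qed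
    ultimately show "bij_betw T ?S (omega1 E)"
      using T_omega1 by (auto simp: bij_betw_def)
  qed
  moreover have "bij_betw T ?S (omega1 E) \<longleftrightarrow> bij_betw (restrict T ?S) ?S (omega1 E)"
    by (rule bij_betw_cong) simp
  moreover have "A x = (\<lambda>a y. coef (e (b a)) x y)" for x
    by (simp add: A_def fun_eq_iff)
  ultimately show ?thesis by (simp only: restr)
qed

section \<open>Beins as families of 1-forms; existence\<close>

lemma vbein_iff_bein_forms:
  fixes \<Sigma> :: "'s set" and V :: "'v::complex_vector set"
  assumes "finite \<Sigma>" "E \<subseteq> \<Sigma> \<times> \<Sigma> - Id" "fin_dim V" "is_basis V I b"
  shows "vbein comult counit \<Sigma> E V \<rho> e \<longleftrightarrow>
    right_comodule comult counit V \<rho> \<and> e \<in> lin_maps V (omega1 E) \<and> (\<lambda>a\<in>I. e (b a)) \<in> bein_forms \<Sigma> E I"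
proof -
  have finE: "finite E" using assms by (meson finite_Diff finite_SigmaI finite_subset)
  have "bij_betw (tensor_lift (functions_on \<Sigma>) V (\<lambda>m v. lact m (e v)))
           (tensor_space (functions_on \<Sigma>) V) (omega1 E) \<longleftrightarrow> (\<lambda>a\<in>I. e (b a)) \<in> bein_forms \<Sigma> E I"
    if e: "e \<in> lin_maps V (omega1 E)"
  proof -
    \<comment> \<open>The lifted map and the forms \<open>e (b a)\<close> only see values of
      \<open>e\<close> on \<open>V\<close>, so the total extension may replace it.\<close>
    obtain e' where e': "clinear e'" "\<And>v. v \<in> V \<Longrightarrow> e v = e' v"
      using lin_maps_extend[OF e is_basis_subspace[OF assms(4)]] by metis
    have om: "e' v \<in> omega1 E" if "v \<in> V" for v
    proof -
      have "e v \<in> omega1 E" using e that by (auto simp: lin_maps_def)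
      then show ?thesis by (simp add: e'(2)[OF that])
    qed
    have "tensor_lift (functions_on \<Sigma>) V (\<lambda>m v. lact m (e v))
        = tensor_lift (functions_on \<Sigma>) V (\<lambda>m v. lact m (e' v))"
      by (rule tensor_lift_cong) (simp add: e'(2))
    then have "bij_betw (tensor_lift (functions_on \<Sigma>) V (\<lambda>m v. lact m (e v)))
        (tensor_space (functions_on \<Sigma>) V) (omega1 E) \<longleftrightarrow>
        (\<forall>x\<in>\<Sigma>. invertible_matrix I (fibre E x) (\<lambda>a y. coef (e' (b a)) x y))"
      using bij_betw_lact_iff_invertible[OF assms(1,2) is_basis_finite[OF assms(4,3)] assms(4) e'(1) om]
      by simp
    also have "\<dots> \<longleftrightarrow> (\<forall>x\<in>\<Sigma>. invertible_matrix I (fibre E x) (\<lambda>a y. coef ((\<lambda>a\<in>I. e (b a)) a) x y))"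
      by (intro ball_cong refl invertible_matrix_cong) (simp add: e'(2) is_basis_in[OF assms(4)])
    also have "\<dots> \<longleftrightarrow> (\<lambda>a\<in>I. e (b a)) \<in> bein_forms \<Sigma> E I"
      using om e'(2) is_basis_in[OF assms(4)] by (auto simp: bein_forms_iff[OF finE])
    finally show ?thesis .
  qed
  then show ?thesis using assms(3) unfolding vbein_def by blast
qed

text \<open>The matrix at x is square, with \<open>dim V\<close> rows. As this number does not
  depend on x, E is fibred.\<close>

lemma vbein_card_fibre:
  assumes "finite \<Sigma>" "E \<subseteq> \<Sigma> \<times> \<Sigma> - Id" "vbein comult counit \<Sigma> E V \<rho> e" "x \<in> \<Sigma>"
  shows "card (fibre E x) = cvec.dim V"
proof -
  have V: "fin_dim V" using assms(3) by (simp add: vbein_def)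
  obtain B where B: "is_basis V B (\<lambda>v. v)" using fin_dim_basis[OF V] .
  have "(\<lambda>a\<in>B. e a) \<in> bein_forms \<Sigma> E B"
    using assms(3) unfolding vbein_iff_bein_forms[OF assms(1,2) V B] by blast
  then have "card B = card (fibre E x)"
    using assms(4) invertible_matrix_card unfolding bein_forms_def by blast
  then show ?thesis using is_basis_card[OF B] by simp
qed

lemma vbein_exists:
  assumes "finite \<Sigma>" "E \<subseteq> \<Sigma> \<times> \<Sigma> - Id" "fin_dim V" "right_comodule comult counit V \<rho>"
    and card: "\<And>x. x \<in> \<Sigma> \<Longrightarrow> card (fibre E x) = cvec.dim V"
  shows "\<exists>e. vbein comult counit \<Sigma> E V \<rho> e"
proof -
  have finE: "finite E" using assms by (meson finite_Diff finite_SigmaI finite_subset)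
  obtain B where B: "is_basis V B (\<lambda>v. v)" using fin_dim_basis[OF assms(3)] .
  note finB = is_basis_finite[OF B assms(3)]
  have "\<exists>\<sigma>. bij_betw \<sigma> B (fibre E x)" if "x \<in> \<Sigma>" for x
  proof (rule finite_same_card_bij[OF finB])
    show "finite (fibre E x)"
      using finE by (rule finite_surj[where f = snd]) (force simp: fibre_def)
    show "card B = card (fibre E x)" using card[OF that] is_basis_card[OF B] by simp
  qed
  then obtain \<sigma> where \<sigma>: "\<And>x. x \<in> \<Sigma> \<Longrightarrow> bij_betw (\<sigma> x) B (fibre E x)" by metis
  \<comment> \<open>Each \<open>F a\<close> picks exactly one arrow out of every point x, the one
    ending at \<open>\<sigma> x a\<close>.\<close>
  define F where "F = (\<lambda>a\<in>B. \<Sum>(x, y)\<in>E. (if \<sigma> x a = y then 1 else 0) *\<^sub>C (delta x \<otimes> delta y))"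
  have "F \<in> B \<rightarrow>\<^sub>E omega1 E"
    by (auto simp: F_def intro!: cvec.subspace_sum cvec.subspace_scale subspace_omega1 delta_omega1)
  moreover from this have "F \<in> bein_forms \<Sigma> E B"
    unfolding bein_forms_def
    using invertible_matrix_permutation[OF \<sigma> finB]
    by (auto simp: F_def intro!: exI[of _ "\<lambda>a x y. if \<sigma> x a = y then 1 else 0"])
  moreover obtain e where "e \<in> lin_maps V (omega1 E)" "F = (\<lambda>a\<in>B. e a)"
    using bij_betw_imp_surj_on[OF bij_betw_lin_maps_basis[OF B finB subspace_omega1[of E]]]
      \<open>F \<in> B \<rightarrow>\<^sub>E omega1 E\<close> by blast
  ultimately show ?thesis
    using assms(4) vbein_iff_bein_forms[OF assms(1-3) B, of comult counit \<rho> e] by blast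
qed

section \<open>The trivial coaction\<close>

text \<open>The outer lift evaluates as expected only once the inner one is known to be linear in
  \<open>c\<close> as well, where \<open>c\<close> is a mere parameter of the lift;
  \<open>add\<close> and \<open>scale\<close> check this on pure tensors.\<close>

lemma tensor_assoc_tensor_prod: "tensor_assoc ((a \<otimes> b) \<otimes> c) = a \<otimes> (b \<otimes> c)"
  for a :: "'a::complex_vector" and b :: "'b::complex_vector" and c :: "'c::complex_vector"
proof -
  let ?L = "\<lambda>c :: 'c. tensor_lift UNIV UNIV (\<lambda>(a :: 'a) (b :: 'b). a \<otimes> (b \<otimes> c))"
  have "bilinear_on UNIV UNIV (\<lambda>(a :: 'a) (b :: 'b). a \<otimes> (b \<otimes> c))" for c :: 'c
    by (simp add: bilinear_on_def tensor_prod_add_left tensor_prod_add_right tensor_prod_scaleC_left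
        tensor_prod_scaleC_right)
  note L = tensor_lift_UNIV[OF this]
  have add: "?L (c + d) t = ?L c t + ?L d t" for c d t
  proof (rule clinear_eq_on_tensor[OF L(1)])
    show "clinear (\<lambda>t. ?L c t + ?L d t)"
      by (rule clinearI) (simp_all add: clinear_add[OF L(1)] clinear_scaleC[OF L(1)] scaleC_add_right)
    show "?L (c + d) (a \<otimes> b) = ?L c (a \<otimes> b) + ?L d (a \<otimes> b)" for a b
      unfolding L(2) by (simp only: tensor_prod_add_right)
  qed
  have scale: "?L (k *\<^sub>C c) t = k *\<^sub>C ?L c t" for k c t
  proof (rule clinear_eq_on_tensor[OF L(1)])
    show "clinear (\<lambda>t. k *\<^sub>C ?L c t)"
      by (rule clinearI)
        (simp_all add: clinear_add[OF L(1)] clinear_scaleC[OF L(1)] scaleC_add_right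
          cvec.scale_left_commute)
    show "?L (k *\<^sub>C c) (a \<otimes> b) = k *\<^sub>C ?L c (a \<otimes> b)" for a b
      unfolding L(2) by (simp only: tensor_prod_scaleC_right)
  qed
  have "bilinear_on UNIV UNIV (\<lambda>t c. ?L c t)"
    by (simp add: bilinear_on_def clinear_add[OF L(1)] clinear_scaleC[OF L(1)] add scale)
  from tensor_lift_UNIV(2)[OF this] show ?thesis by (simp add: tensor_assoc_def L(2))
qed

text \<open>Both sides of coassociativity become \<open>v \<otimes> (1 \<otimes> 1)\<close> because
  \<open>comult 1 = 1 \<otimes> 1\<close>, and the counit law reduces to
  \<open>counit 1 = 1\<close>.\<close>

lemma right_comodule_trivial:
  fixes V :: "'v::complex_vector set"
  assumes "hopf_algebra comult counit antipode" "cvec.subspace V"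
  shows "right_comodule comult counit V (\<lambda>v\<in>V. v \<otimes> 1)"
proof -
  interpret hopf_algebra comult counit antipode by (rule assms(1))
  let ?\<rho> = "\<lambda>v\<in>V. v \<otimes> (1 :: 'a)"
  note V = assms(2)
  \<comment> \<open>Bilinearity can be claimed on \<open>V\<close> only, as \<open>?\<rho>\<close>
    is undefined elsewhere.\<close>
  have "bilinear_on V UNIV (\<lambda>v h :: 'a. ?\<rho> v \<otimes> id h)"
    by (auto simp: bilinear_on_def tensor_prod_add_left tensor_prod_add_right tensor_prod_scaleC_left
        tensor_prod_scaleC_right cvec.subspace_add[OF V] cvec.subspace_scale[OF V])
  note L = tensor_lift_apply[OF V cvec.subspace_UNIV this]
  have 1: "tensor_map V UNIV ?\<rho> id (v \<otimes> h) = (v \<otimes> 1) \<otimes> h" if "v \<in> V" for v and h :: 'a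
    unfolding tensor_map_def using L[OF that UNIV_I, of h] that by simp
  have "bilinear_on V UNIV (\<lambda>(v :: 'v) h. id v \<otimes> comult h)"
    by (simp add: bilinear_on_def tensor_prod_add_left tensor_prod_add_right tensor_prod_scaleC_left
        tensor_prod_scaleC_right clinear_add[OF comult_linear] clinear_scaleC[OF comult_linear])
  note L = tensor_lift_apply[OF V cvec.subspace_UNIV this]
  have 2: "tensor_map V UNIV id comult (v \<otimes> h) = v \<otimes> comult h" if "v \<in> V" for v h
    unfolding tensor_map_def using L[OF that UNIV_I, of h] by simp
  have "bilinear_on V UNIV (\<lambda>(v :: 'v) h. counit h *\<^sub>C v)"
    by (simp add: bilinear_on_def clinear_add[OF counit_linear] clinear_scaleC[OF counit_linear]
        scaleC_add_left scaleC_add_right scaleC_scaleC scaleC_complex_def mult.commute)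
  note 3 = tensor_lift_apply[OF V cvec.subspace_UNIV this]
  show ?thesis
    using V cvec.subspace_add[OF V] cvec.subspace_scale[OF V]
    by (auto simp: right_comodule_def lin_maps_def tensor_in_tensor_space tensor_prod_add_left
        tensor_prod_scaleC_left 1 2 3 tensor_assoc_tensor_prod comult_one counit_one scaleC_one)
qed

section \<open>The correspondence, the existence criterion and the count\<close>

theorem lemma5p1:
  fixes \<Sigma> :: "'s set" and E :: "('s \<times> 's) set"
    and comult :: "'h::complex_algebra_1 \<Rightarrow> ('h, 'h) tensor"
    and counit :: "'h \<Rightarrow> complex" and antipode :: "'h \<Rightarrow> 'h"
    and V :: "'v::complex_vector set"
  assumes "finite \<Sigma>"
    and "E \<subseteq> \<Sigma> \<times> \<Sigma> - Id"
    and "hopf_algebra comult counit antipode"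
    and "fin_dim V"
  shows "(\<forall>(I :: 'i set) b. is_basis V I b \<longrightarrow>
            bij_betw (\<lambda>(\<rho>, e). (\<rho>, \<lambda>a\<in>I. e (b a)))
              {(\<rho>, e). vbein comult counit \<Sigma> E V \<rho> e}
              {(\<rho>, F). right_comodule comult counit V \<rho> \<and> F \<in> bein_forms \<Sigma> E I}) \<and>
         (\<forall>\<rho>. right_comodule comult counit V \<rho> \<longrightarrow>
            ((\<exists>e. vbein comult counit \<Sigma> E V \<rho> e) \<longleftrightarrow>
             fibred_over \<Sigma> E \<and> (\<forall>x\<in>\<Sigma>. card (fibre E x) = cvec.dim V))) \<and>
         ((\<exists>(W :: (nat \<Rightarrow> complex) set) \<rho> e. vbein comult counit \<Sigma> E W \<rho> e) \<longleftrightarrow> fibred_over \<Sigma> E) \<and>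
         (fibred_over \<Sigma> E \<and> (\<forall>x\<in>\<Sigma>. card (fibre E x) = cvec.dim V) \<longrightarrow>
            card E = card \<Sigma> * cvec.dim V)"
proof (intro conjI allI impI)
  have finE: "finite E" using assms by (meson finite_Diff finite_SigmaI finite_subset)
  show "bij_betw (\<lambda>(\<rho>, e). (\<rho>, \<lambda>a\<in>I. e (b a)))
      {(\<rho>, e). vbein comult counit \<Sigma> E V \<rho> e}
      {(\<rho>, F). right_comodule comult counit V \<rho> \<and> F \<in> bein_forms \<Sigma> E I}"
    if basis: "is_basis V I b" for I :: "'i set" and b
  proof -
    note bij = bij_betw_lin_maps_basis[OF basis is_basis_finite[OF basis assms(4)] subspace_omega1[of E]]
    note iff = vbein_iff_bein_forms[OF assms(1,2,4) basis]
    have "inj_on (\<lambda>(\<rho>, e). (\<rho>, \<lambda>a\<in>I. e (b a))) {(\<rho>, e). vbein comult counit \<Sigma> E V \<rho> e}"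
      using bij_betw_imp_inj_on[OF bij] by (auto simp: inj_on_def iff)
    moreover have "(\<rho>, F) \<in> (\<lambda>(\<rho>, e). (\<rho>, \<lambda>a\<in>I. e (b a))) ` {(\<rho>, e). vbein comult counit \<Sigma> E V \<rho> e}"
      if "right_comodule comult counit V \<rho>" "F \<in> bein_forms \<Sigma> E I" for \<rho> F
    proof -
      have "F \<in> I \<rightarrow>\<^sub>E omega1 E" using that(2) by (simp add: bein_forms_def)
      then obtain e where "e \<in> lin_maps V (omega1 E)" "F = (\<lambda>a\<in>I. e (b a))"
        using bij_betw_imp_surj_on[OF bij] by blast
      then show ?thesis using that by (auto simp: iff intro!: image_eqI[of _ _ "(\<rho>, e)"])
    qed
    moreover have "(\<rho>, \<lambda>a\<in>I. e (b a)) \<in> {(\<rho>, F). right_comodule comult counit V \<rho> \<and> F \<in> bein_forms \<Sigma> E I}"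
      if "vbein comult counit \<Sigma> E V \<rho> e" for \<rho> e
      using that by (simp add: iff)
    ultimately show ?thesis
      unfolding bij_betw_def by (intro conjI equalityI subsetI) (assumption, clarsimp, blast)
  qed
  show "(\<exists>e. vbein comult counit \<Sigma> E V \<rho> e) \<longleftrightarrow>
      fibred_over \<Sigma> E \<and> (\<forall>x\<in>\<Sigma>. card (fibre E x) = cvec.dim V)"
    if "right_comodule comult counit V \<rho>" for \<rho>
  proof
    assume "\<exists>e. vbein comult counit \<Sigma> E V \<rho> e"
    then obtain e where "vbein comult counit \<Sigma> E V \<rho> e" ..
    from vbein_card_fibre[OF assms(1,2) this]
    show "fibred_over \<Sigma> E \<and> (\<forall>x\<in>\<Sigma>. card (fibre E x) = cvec.dim V)"
      by (simp add: fibred_over_def)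
  next
    assume "fibred_over \<Sigma> E \<and> (\<forall>x\<in>\<Sigma>. card (fibre E x) = cvec.dim V)"
    then show "\<exists>e. vbein comult counit \<Sigma> E V \<rho> e"
      by (intro vbein_exists[OF assms(1,2,4) that]) blast
  qed
  show "(\<exists>(W :: (nat \<Rightarrow> complex) set) \<rho> e. vbein comult counit \<Sigma> E W \<rho> e) \<longleftrightarrow> fibred_over \<Sigma> E"
  proof
    assume "\<exists>(W :: (nat \<Rightarrow> complex) set) \<rho> e. vbein comult counit \<Sigma> E W \<rho> e"
    then obtain W :: "(nat \<Rightarrow> complex) set" and \<rho> e where "vbein comult counit \<Sigma> E W \<rho> e" by blast
    from vbein_card_fibre[OF assms(1,2) this] show "fibred_over \<Sigma> E"
      by (simp add: fibred_over_def)
  next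
    assume "fibred_over \<Sigma> E"
    \<comment> \<open>If \<Sigma> is empty, any n will do.\<close>
    then obtain n where n: "\<And>x. x \<in> \<Sigma> \<Longrightarrow> card (fibre E x) = n"
      unfolding fibred_over_def by metis
    \<comment> \<open>The type \<open>nat \<Rightarrow> complex\<close> contains a subspace of every
      finite dimension, so one fixed type serves for all possible fibre sizes.\<close>
    let ?W = "functions_on {..<n}"
    have basis: "is_basis ?W {..<n} delta" by (rule is_basis_delta) simp
    have "fin_dim ?W"
      using basis subspace_functions_on[of "{..<n}"]
      by (auto simp: fin_dim_def is_basis_def intro!: exI[of _ "delta ` {..<n}"])
    from vbein_exists[OF assms(1,2) this right_comodule_trivial[OF assms(3) subspace_functions_on]]
    have "\<exists>e. vbein comult counit \<Sigma> E ?W (\<lambda>v\<in>?W. v \<otimes> 1) e"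
      using n is_basis_card[OF basis] by simp
    then show "\<exists>(W :: (nat \<Rightarrow> complex) set) \<rho> e. vbein comult counit \<Sigma> E W \<rho> e" by blast
  qed
  show "card E = card \<Sigma> * cvec.dim V"
    if "fibred_over \<Sigma> E \<and> (\<forall>x\<in>\<Sigma>. card (fibre E x) = cvec.dim V)"
  proof -
    \<comment> \<open>E is the disjoint union of its fibres, since every arrow starts in
      \<Sigma>.\<close>
    have "(SIGMA x:\<Sigma>. fibre E x) = E" using assms(2) by (auto simp: fibre_def)
    moreover have "finite (fibre E x)" for x
      using finE by (rule finite_surj[where f = snd]) (force simp: fibre_def)
    ultimately have "card E = (\<Sum>x\<in>\<Sigma>. card (fibre E x))"
      using card_SigmaI[OF assms(1), of "fibre E"] by simp
    then show ?thesis using that by simp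
  qed
qed

end
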